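(* Let $\Xi$ be an ordered strict associative clan, let $q\in\mathbb R$, let $\delta=((C_1:\mathbf H_1,\dots,C_p:\mathbf H_p),\mathbf H)$ be a $\Xi$-delegation, and let $\emptyset\neq B\subseteq\{1,\dots,p\}$. Then the following equalities hold in the real vector space spanned by the constructs of $\mathbf H$: $$\ast(\delta)=\ast^{\lceil}(\delta)=\ast^{\leq}(\delta)\qquad\text{and}\qquad \ast_B(\delta)=\ast_B^{\lceil}(\delta)=\ast_B^{\leq}(\delta).$$
   Context: **Hypergraphs and constructs.** A (finite) hypergraph $\mathbf H$ with finite vertex set $H$ is a set of non-empty subsets of $H$ (hyperedges) with $\bigcup\mathbf H=H$ and $\{x\}\in\mathbf H$ for all $x\in H$. For $X\subseteq H$, $\mathbf H_X:=\{Z\in\mathbf H: Z\subseteq X\}$ and $\mathbf H\setminus X:=\mathbf H_{H\setminus X}$. $\mathbf H$ is connected if there is no partition $H=X_1\cup X_2$ into two non-empty parts with $\mathbf H=\mathbf H_{X_1}\cup\mathbf H_{X_2}$; $X\subseteq H$ is connected in $\mathbf H$ if $\mathbf H_X$ is connected. $\mathbf H,X\leadsto H_1,\dots,H_n$ means that $\mathbf H_{H_1},\dots,\mathbf H_{H_n}$ are the connected components of $\mathbf H\setminus X$. Constructs of a connected hypergraph $\mathbf H$ are non-planar rooted trees with nodes labelled by non-empty subsets of $H$: the one-node tree $H$ is a construct; if $\emptyset\neq Y\subsetneq H$, $\mathbf H,Y\leadsto H_1,\dots,H_n$ and $T_i$ is a construct of $\mathbf H_{H_i}$, then $Y(T_1,\dots,T_n)$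 (root $Y$, immediate subtrees $T_i$) is a construct. $T:\mathbf H$ means $T$ is a construct of $\mathbf H$. **Order.** All vertex sets are finite subsets of $\mathbb Z$ with the induced order; $Y<Z$ means $\max Y<\min Z$. $\mathbf H$ is hereditarily ordered if for every non-empty $X\subseteq H$ the components of $\mathbf H\setminus X$ can be indexed so that $H_1<\cdots<H_n$. If in $S$ the node $X$ is the parent of $Y$, contracting this edge (merged label $X\cup Y$) yields a construct $T$; write $S\subset_{X,Y}T$. $S\lessdot S'$ iff there are $U>V$ with $S\subset_{U,V}S'$ or $S'\subset_{V,U}S$. The generalised flip order $\leq$ is the reflexive transitive closure of $\lessdot$. **Restriction.** Let $\mathbf K$ be a connected hypergraph with $K\subseteq H$, each hyperedge of $\mathbf K$ being connected in $\mathbf H$, and $C:\mathbf H$. The restriction $C_{\lceil\mathbf K}:\mathbf K$ is: $K$ if $C=H$; if $C=X(C_1,\dots,C_n)$ with $\mathbf H,X\leadsto H_1,\dots,H_n$ and $X\cap K=\emptyset$, then $K\subseteq H_i$ for some $i$ and $C_{\lceil\mathbf K}=(C_i)_{\lceil\mathbf K}$; if $X\cap K\ne\emptyset$ and $\mathbf K,X\cap K\leadsto K_1,\dots,K_r$, then each $K_j$ lies in some $H_{\psi(j)}$ and $C_{\lceil\mathbf K}=(X\cap K)((C_{\psi(1)})_{\lceil\mathbf K_{K_1}},\dots,(C_{\psi(r)})_{\lceil\mathbf K_{K_r}})$. **Teams and clans.** Fix a $\mathbb Z$-ordered universe $\mathfrak U$: a collection of connected hypergraphs with vertices in $\mathbb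 Z$, each hereditarily ordered. An ordered strict team is $\tau=((\mathbf H_1,\dots,\mathbf H_p),\mathbf H)$ with all $\mathbf H_a,\mathbf H\in\mathfrak U$, the $H_a$ pairwise disjoint, $H=\bigcup_aH_a$, $H_1<\cdots<H_p$, and such that every non-empty $K\subseteq H_a$ connected in $\mathbf H_a$ is connected in $\mathbf H$. Put $A=\{1,\dots,p\}$. For $\emptyset\neq B\subseteq A$ and $\emptyset\neq X_b\subseteq H_b$ ($b\in B$), let $\mathbf H_b,X_b\leadsto H_{(b,1)},\dots,H_{(b,n_b)}$, $X_B=\bigcup_{b\in B}X_b$, $\mathbf H,X_B\leadsto H_1^B,\dots,H_{n_B}^B$, and $\tilde A=(A\setminus B)\cup\{(b,i):b\in B,1\le i\le n_b\}$. Each $H_{\tilde a}$ ($\tilde a\in\tilde A$) is contained in exactly one $H_i^B$. The induced (ordered) teams are $\tau_i^B$, with coordinating hypergraph $\mathbf H_i^B=\mathbf H_{H_i^B}$ and participating hypergraphs those $\mathbf H_{\tilde a}$ with $H_{\tilde a}\subseteq H_i^B$ (listed increasingly), where $\mathbf H_{(b,i)}=(\mathbf H_b)_{H_{(b,i)}}$. An ordered strict clan $\Xi$ is a set of ordered strict teams such that $\tau\in\Xi$ implies all $\tau_i^B\in\Xi$ for all choices of $B$ and $(X_b)$. It is associative if whenever $\tau=(\{\mathbf H_a\}_{a\in A},\mathbf H)\in\Xi$, $a_0\in A$, and $\tau'=(\{\mathbf H_{(a_0,a')}\}_{a'\in A'},\mathbf H_{a_0})\in\Xi$, the team obtained from $\tau$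 by replacing $\mathbf H_{a_0}$ with all the $\mathbf H_{(a_0,a')}$ is in $\Xi$. **Delegations.** A $\Xi$-delegation is $\delta=((C_1:\mathbf H_1,\dots,C_p:\mathbf H_p),\mathbf H)$ with $\tau=((\mathbf H_1,\dots,\mathbf H_p),\mathbf H)\in\Xi$. Put $X_a=\mathrm{root}(C_a)$. For $\emptyset\ne B\subseteq A$, writing $C_b=X_b(C_{(b,1)},\dots,C_{(b,n_b)})$ for $b\in B$ with $C_{(b,i)}:\mathbf H_{(b,i)}$, the induced delegations $\delta_i^B$ ($1\le i\le n_B$) consist of the $C_{\tilde a}:\mathbf H_{\tilde a}$ with $H_{\tilde a}\subseteq H_i^B$, and coordinating hypergraph $\mathbf H_i^B$. **Products.** Recursively (extending grafting multilinearly), $\ast(\delta)=\sum_{\emptyset\ne B\subseteq A}q^{|B|-1}\ast_B(\delta)$, where $\ast_B(\delta)=X_B(\ast(\delta_1^B),\dots,\ast(\delta_{n_B}^B))$. Recursively define constructs of $\mathbf H$: $\backslash(\delta)=X_1(\backslash(\delta_1^{\{1\}}),\dots,\backslash(\delta^{\{1\}}_{n_{\{1\}}}))$ and $/(\delta)=X_p(/(\delta_1^{\{p\}}),\dots,/(\delta^{\{p\}}_{n_{\{p\}}}))$; and for $B$: $/^B(\delta)=X_B(/(\delta_1^B),\dots,/(\delta_{n_B}^B))$, $\backslash_B(\delta)=X_B(\backslash(\delta_1^B),\dots,\backslash(\delta_{n_B}^B))$. For $U=X(U_1,\dots,U_n):\mathbf H$, let $B'=\{b\in A:X\cap H_b\neq\emptyset\}$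 and use the subsets $X\cap H_b$, $b\in B'$, to form the induced teams $\tau_1,\dots,\tau_n$ (so $U_i$ is a construct of the coordinating hypergraph of $\tau_i$); define $\mu^\tau(U)=(|B'|-1)+\sum_{i=1}^n\mu^{\tau_i}(U_i)$. Then (with $q^0=1$): $\ast^{\lceil}(\delta)=\sum q^{\mu^\tau(U)}U$ over $U:\mathbf H$ with $U_{\lceil\mathbf H_i}=C_i$ for all $1\le i\le p$; $\ast_B^{\lceil}(\delta)=\sum q^{\mu^\tau(U)-|B|+1}U$ over $U:\mathbf H$ with $\mathrm{root}(U)=X_B$ and $U_{\lceil\mathbf H_i}=C_i$ for all $i$; $\ast^{\le}(\delta)=\sum q^{\mu^\tau(U)}U$ over $U:\mathbf H$ with $/(\delta)\le U\le\backslash(\delta)$; $\ast_B^{\le}(\delta)=\sum q^{\mu^\tau(U)-|B|+1}U$ over $U:\mathbf H$ with $/^B(\delta)\le U\le\backslash_B(\delta)$. *)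

theory Defs
  imports Complex_Main "HOL-Library.FSet" "HOL-Library.FuncSet" "HOL-Library.Poly_Mapping"
begin

section \<open>Hypergraphs\<close>

text \<open>A hypergraph is given by its set of hyperedges; its vertex set is the union \<open>\<Union>H\<close>.\<close>

type_synonym hypergraph = "int set set"

definition hypergraph :: "hypergraph \<Rightarrow> bool" where
  "hypergraph H \<longleftrightarrow> finite (\<Union>H) \<and> {} \<notin> H \<and> (\<forall>x\<in>\<Union>H. {x} \<in> H)"

definition induce :: "hypergraph \<Rightarrow> int set \<Rightarrow> hypergraph" where
  "induce H X = {Z\<in>H. Z \<subseteq> X}"

definition delete :: "hypergraph \<Rightarrow> int set \<Rightarrow> hypergraph" where
  "delete H X = induce H (\<Union>H - X)"

text \<open>The empty hypergraph is not counted as connected: construct labels are non-empty, and the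
  order on vertex sets uses their extremal elements.\<close>

definition hg_connected :: "hypergraph \<Rightarrow> bool" where
  "hg_connected H \<longleftrightarrow> \<Union>H \<noteq> {} \<and>
     \<not> (\<exists>X Y. X \<noteq> {} \<and> Y \<noteq> {} \<and> X \<inter> Y = {} \<and> X \<union> Y = \<Union>H \<and> H = induce H X \<union> induce H Y)"

definition connected_in :: "hypergraph \<Rightarrow> int set \<Rightarrow> bool" where
  "connected_in H X \<longleftrightarrow> X \<subseteq> \<Union>H \<and> hg_connected (induce H X)"

text \<open>A component is represented by its vertex set \<open>Z\<close>; as a hypergraph it is \<open>induce H Z\<close>.
  So \<open>H, X \<leadsto> H\<^sub>1, \<dots>, H\<^sub>n\<close> reads \<open>{H\<^sub>1, \<dots>, H\<^sub>n} = hg_components (delete H X)\<close>.\<close>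

definition hg_components :: "hypergraph \<Rightarrow> int set set" where
  "hg_components H = {Z. connected_in H Z \<and> (\<forall>Y. connected_in H Y \<and> Z \<subseteq> Y \<longrightarrow> Y = Z)}"

definition set_less :: "int set \<Rightarrow> int set \<Rightarrow> bool" where
  "set_less Y Z \<longleftrightarrow> Max Y < Min Z"

definition hereditarily_ordered :: "hypergraph \<Rightarrow> bool" where
  "hereditarily_ordered H \<longleftrightarrow>
     (\<forall>X. X \<noteq> {} \<and> X \<subseteq> \<Union>H \<longrightarrow>
        (\<exists>Zs. distinct Zs \<and> set Zs = hg_components (delete H X) \<and> sorted_wrt set_less Zs))"


section \<open>Constructs\<close>

text \<open>Non-planar trees. Distinct subtrees of a node of a construct have disjoint sets of vertices, so a
  finite set of immediate subtrees loses no information.\<close>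

datatype ctree = Node (root_label: "int set") (children: "ctree fset")

primrec verts :: "ctree \<Rightarrow> int set" where
  "verts (Node X cs) = X \<union> \<Union> (fset (verts |`| cs))"

text \<open>The tree \<open>X(T Z\<^sub>1, \<dots>, T Z\<^sub>n)\<close> for \<open>I = {Z\<^sub>1, \<dots>, Z\<^sub>n}\<close> finite.\<close>

definition plant :: "int set \<Rightarrow> int set set \<Rightarrow> (int set \<Rightarrow> ctree) \<Rightarrow> ctree" where
  "plant X I T = Node X (Abs_fset (T ` I))"

lemma plant_cong [fundef_cong]:
  "X = X' \<Longrightarrow> I = I' \<Longrightarrow> (\<And>Z. Z \<in> I' \<Longrightarrow> T Z = T' Z) \<Longrightarrow> plant X I T = plant X' I' T'"
  unfolding plant_def by (simp cong: image_cong)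

inductive construct :: "hypergraph \<Rightarrow> ctree \<Rightarrow> bool" where
  whole: "hypergraph H \<Longrightarrow> hg_connected H \<Longrightarrow> construct H (Node (\<Union>H) {||})"
| plant: "hypergraph H \<Longrightarrow> hg_connected H \<Longrightarrow> Y \<noteq> {} \<Longrightarrow> Y \<subset> \<Union>H \<Longrightarrow>
    (\<And>Z. Z \<in> hg_components (delete H Y) \<Longrightarrow> construct (induce H Z) (T Z)) \<Longrightarrow>
    construct H (plant Y (hg_components (delete H Y)) T)"

text \<open>\<open>contracts X Y S T\<close>: in \<open>S\<close> the node \<open>X\<close> is the parent of \<open>Y\<close>, and \<open>T\<close> results from contracting
  this edge.\<close>

inductive contracts :: "int set \<Rightarrow> int set \<Rightarrow> ctree \<Rightarrow> ctree \<Rightarrow> bool" for X Y where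
  here: "Node Y ds |\<in>| cs \<Longrightarrow> contracts X Y (Node X cs) (Node (X \<union> Y) ((cs |-| {|Node Y ds|}) |\<union>| ds))"
| below: "c |\<in>| cs \<Longrightarrow> contracts X Y c d \<Longrightarrow> contracts X Y (Node Z cs) (Node Z (finsert d (cs |-| {|c|})))"

definition flip_step :: "hypergraph \<Rightarrow> ctree \<Rightarrow> ctree \<Rightarrow> bool" where
  "flip_step H S S' \<longleftrightarrow> construct H S \<and> construct H S' \<and>
     (\<exists>U V. set_less V U \<and> (contracts U V S S' \<or> contracts V U S' S))"

definition flip_le :: "hypergraph \<Rightarrow> ctree \<Rightarrow> ctree \<Rightarrow> bool" where
  "flip_le H = (flip_step H)\<^sup>*\<^sup>*"

lemma size_child: "c |\<in>| cs \<Longrightarrow> size c < size (Node X cs)"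
proof -
  assume "c |\<in>| cs"
  then have "Suc (size c) \<le> (\<Sum>x\<in>fset cs. Suc (size x))"
    by (intro member_le_sum) auto
  then show ?thesis by simp
qed

text \<open>\<open>construct_restrict C K\<close> is the restriction of \<open>C : H\<close> to \<open>K\<close>. The hypergraph \<open>H\<close> is not an
  argument: the components of \<open>H\<close> minus the root are the vertex sets of the immediate subtrees, and
  there are no immediate subtrees exactly when the root is all of \<open>H\<close>.\<close>

function construct_restrict :: "ctree \<Rightarrow> hypergraph \<Rightarrow> ctree" where
  "construct_restrict (Node X cs) K =
     (if cs = {||} then Node (\<Union>K) {||}
      else if X \<inter> \<Union>K = {} then
        (THE D. \<exists>c\<in>fset cs. \<Union>K \<subseteq> verts c \<and> D = construct_restrict c K)
      else Node (X \<inter> \<Union>K)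
        (Abs_fset {D. \<exists>Z\<in>hg_components (delete K (X \<inter> \<Union>K)). \<exists>c\<in>fset cs.
                       Z \<subseteq> verts c \<and> D = construct_restrict c (induce K Z)}))"
  by pat_completeness auto
termination
  by (relation "measure (size \<circ> fst)") (use size_child in \<open>auto simp del: ctree.size\<close>)


section \<open>Teams and clans\<close>

text \<open>A team is a list of participating hypergraphs together with the coordinating one. The index set
  \<open>A\<close> is \<open>{..<p}\<close>, so indices start at \<open>0\<close>.\<close>

type_synonym team = "hypergraph list \<times> hypergraph"

definition ordered_universe :: "hypergraph set \<Rightarrow> bool" where
  "ordered_universe \<UU> \<longleftrightarrow> (\<forall>H\<in>\<UU>. hypergraph H \<and> hg_connected H \<and> hereditarily_ordered H)"

definition ordered_strict_team :: "hypergraph set \<Rightarrow> team \<Rightarrow> bool" where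
  "ordered_strict_team \<UU> \<tau> \<longleftrightarrow> (case \<tau> of (Hs, H) \<Rightarrow>
     set Hs \<subseteq> \<UU> \<and> H \<in> \<UU> \<and>
     (\<forall>a<length Hs. \<forall>b<length Hs. a \<noteq> b \<longrightarrow> \<Union>(Hs ! a) \<inter> \<Union>(Hs ! b) = {}) \<and>
     \<Union>H = (\<Union>a<length Hs. \<Union>(Hs ! a)) \<and>
     sorted_wrt (\<lambda>K L. set_less (\<Union>K) (\<Union>L)) Hs \<and>
     (\<forall>K\<in>set Hs. \<forall>Y. Y \<noteq> {} \<and> Y \<subseteq> \<Union>K \<and> connected_in K Y \<longrightarrow> connected_in H Y))"

text \<open>The elements of a finite set listed by increasing minimum of their vertex sets \<open>V x\<close>. The
  underlying choice is immaterial when these minima are pairwise distinct.\<close>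

definition listed :: "('a \<Rightarrow> int set) \<Rightarrow> 'a set \<Rightarrow> 'a list" where
  "listed V S = sort_key (\<lambda>x. Min (V x)) (SOME xs. distinct xs \<and> set xs = S)"

text \<open>The participating hypergraphs of \<open>\<tau>\<^sub>i\<^sup>B\<close>, where \<open>Z = H\<^sub>i\<^sup>B\<close>; its coordinating hypergraph
  is \<open>induce H Z\<close>.\<close>

definition induced_parts :: "hypergraph list \<Rightarrow> nat set \<Rightarrow> (nat \<Rightarrow> int set) \<Rightarrow> int set \<Rightarrow> hypergraph list" where
  "induced_parts Hs B X Z = listed Union
     {K. \<Union>K \<subseteq> Z \<and>
         (K \<in> {Hs ! a |a. a \<in> {..<length Hs} - B} \<or>
          K \<in> {induce (Hs ! b) Y |b Y. b \<in> B \<and> Y \<in> hg_components (delete (Hs ! b) (X b))})}"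

definition ordered_strict_clan :: "hypergraph set \<Rightarrow> team set \<Rightarrow> bool" where
  "ordered_strict_clan \<UU> \<Xi> \<longleftrightarrow>
     (\<forall>\<tau>\<in>\<Xi>. ordered_strict_team \<UU> \<tau>) \<and>
     (\<forall>Hs H B X. (Hs, H) \<in> \<Xi> \<and> B \<noteq> {} \<and> B \<subseteq> {..<length Hs} \<and>
        (\<forall>b\<in>B. X b \<noteq> {} \<and> X b \<subseteq> \<Union>(Hs ! b)) \<longrightarrow>
        (\<forall>Z\<in>hg_components (delete H (\<Union>b\<in>B. X b)). (induced_parts Hs B X Z, induce H Z) \<in> \<Xi>))"

definition associative_clan :: "team set \<Rightarrow> bool" where
  "associative_clan \<Xi> \<longleftrightarrow>
     (\<forall>Hs H a Ks. (Hs, H) \<in> \<Xi> \<and> a < length Hs \<and> (Ks, Hs ! a) \<in> \<Xi> \<longrightarrow>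
        (take a Hs @ Ks @ drop (Suc a) Hs, H) \<in> \<Xi>)"


section \<open>Delegations\<close>

type_synonym delegation = "(hypergraph \<times> ctree) list \<times> hypergraph"

definition is_delegation :: "team set \<Rightarrow> delegation \<Rightarrow> bool" where
  "is_delegation \<Xi> \<delta> \<longleftrightarrow> (case \<delta> of (Cs, H) \<Rightarrow>
     (map fst Cs, H) \<in> \<Xi> \<and> (\<forall>(K, C)\<in>set Cs. construct K C))"

definition roots :: "(hypergraph \<times> ctree) list \<Rightarrow> nat set \<Rightarrow> int set" where
  "roots Cs B = (\<Union>b\<in>B. root_label (snd (Cs ! b)))"

text \<open>The participants of \<open>\<delta>\<^sub>i\<^sup>B\<close>, where \<open>Z = H\<^sub>i\<^sup>B\<close>; its coordinating hypergraph is
  \<open>induce H Z\<close>. The component attached to an immediate subtree \<open>c\<close> is \<open>verts c\<close>.\<close>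

definition induced_constructs ::
    "(hypergraph \<times> ctree) list \<Rightarrow> nat set \<Rightarrow> int set \<Rightarrow> (hypergraph \<times> ctree) list" where
  "induced_constructs Cs B Z = listed (\<lambda>(K, C). \<Union>K)
     {(K, C). \<Union>K \<subseteq> Z \<and>
        ((K, C) \<in> {Cs ! a |a. a \<in> {..<length Cs} - B} \<or>
         (K, C) \<in> {(induce (fst (Cs ! b)) (verts c), c) |b c.
                     b \<in> B \<and> c |\<in>| children (snd (Cs ! b))})}"

definition weight :: "(hypergraph \<times> ctree) list \<Rightarrow> nat" where
  "weight Cs = (\<Sum>x\<leftarrow>Cs. size (snd x))"

lemma distinct_listed:
  assumes "finite S"
  shows "distinct (listed V S)" "set (listed V S) = S"
proof -
  have "\<exists>xs. distinct xs \<and> set xs = S" using finite_distinct_list[OF assms] by blast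
  from someI_ex[OF this]
  show "distinct (listed V S)" "set (listed V S) = S"
    by (auto simp: listed_def)
qed

lemma weight_induced:
  assumes B: "B \<noteq> {}" "B \<subseteq> {..<length Cs}"
  shows "weight (induced_constructs Cs B Z) < weight Cs"
proof -
  define w where "w = (\<lambda>x::hypergraph \<times> ctree. size (snd x))"
  define A where "A = {..<length Cs} - B"
  define P where "P = Sigma B (\<lambda>b. fset (children (snd (Cs ! b))))"
  define f where "f = (\<lambda>(b, c). (induce (fst (Cs ! b)) (verts c), c))"
  define S where "S = {(K, C). \<Union>K \<subseteq> Z \<and>
        ((K, C) \<in> {Cs ! a |a. a \<in> {..<length Cs} - B} \<or>
         (K, C) \<in> {(induce (fst (Cs ! b)) (verts c), c) |b c.
                     b \<in> B \<and> c |\<in>| children (snd (Cs ! b))})}"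
  have finB: "finite B" using B(2) finite_subset by blast
  have finP: "finite P" unfolding P_def using finB by auto
  have finA: "finite A" unfolding A_def by simp
  have sub: "S \<subseteq> (\<lambda>a. Cs ! a) ` A \<union> f ` P"
    unfolding S_def A_def P_def f_def by force
  have finS: "finite S" using sub finA finP by (meson finite_UnI finite_imageI finite_subset)
  have "weight (induced_constructs Cs B Z) = sum w S"
    unfolding weight_def induced_constructs_def S_def[symmetric]
    using distinct_listed[OF finS] by (simp add: sum_list_distinct_conv_sum_set w_def)
  also have "\<dots> \<le> sum w ((\<lambda>a. Cs ! a) ` A \<union> f ` P)"
    using sub finA finP by (intro sum_mono2) auto
  also have "\<dots> \<le> sum w ((\<lambda>a. Cs ! a) ` A) + sum w (f ` P)"
    using finA finP by (simp add: sum_Un_nat)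
  also have "\<dots> \<le> (\<Sum>a\<in>A. w (Cs ! a)) + (\<Sum>x\<in>P. w (f x))"
    using sum_image_le[OF finA, of w "\<lambda>a. Cs ! a"] sum_image_le[OF finP, of w f]
    by (simp add: o_def add_mono)
  also have "(\<Sum>x\<in>P. w (f x)) = (\<Sum>b\<in>B. \<Sum>c\<in>fset (children (snd (Cs ! b))). size c)"
    unfolding P_def using finB by (subst sum.Sigma) (auto simp: f_def w_def intro!: sum.cong)
  also have "\<dots> < (\<Sum>b\<in>B. w (Cs ! b))"
  proof (rule sum_strict_mono[OF finB B(1)])
    fix b
    obtain X cs where eq: "snd (Cs ! b) = Node X cs" by (cases "snd (Cs ! b)")
    have "(\<Sum>c\<in>fset cs. size c) \<le> (\<Sum>c\<in>fset cs. Suc (size c))" by (intro sum_mono) auto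
    then show "(\<Sum>c\<in>fset (children (snd (Cs ! b))). size c) < w (Cs ! b)"
      by (simp add: w_def eq)
  qed
  also have "(\<Sum>a\<in>A. w (Cs ! a)) + (\<Sum>b\<in>B. w (Cs ! b)) = (\<Sum>a<length Cs. w (Cs ! a))"
    unfolding A_def using B(2) by (simp add: sum.subset_diff)
  also have "\<dots> = weight Cs"
    by (simp add: weight_def w_def sum_list_sum_nth atLeast0LessThan)
  finally show ?thesis by simp
qed


section \<open>Products\<close>

text \<open>The real vector space freely spanned by trees is \<open>ctree \<Rightarrow>\<^sub>0 real\<close>.\<close>

definition scal :: "real \<Rightarrow> (ctree \<Rightarrow>\<^sub>0 real) \<Rightarrow> (ctree \<Rightarrow>\<^sub>0 real)" where
  "scal r v = Poly_Mapping.map ((*) r) v"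

text \<open>The multilinear extension of grafting: \<open>X(v Z\<^sub>1, \<dots>, v Z\<^sub>n)\<close> for \<open>I = {Z\<^sub>1, \<dots>, Z\<^sub>n}\<close>.\<close>

definition graft :: "int set \<Rightarrow> int set set \<Rightarrow> (int set \<Rightarrow> (ctree \<Rightarrow>\<^sub>0 real)) \<Rightarrow> (ctree \<Rightarrow>\<^sub>0 real)" where
  "graft X I v = (\<Sum>T \<in> (\<Pi>\<^sub>E Z\<in>I. Poly_Mapping.keys (v Z)).
     Poly_Mapping.single (plant X I T) (\<Prod>Z\<in>I. Poly_Mapping.lookup (v Z) (T Z)))"

lemma graft_cong [fundef_cong]:
  assumes "X = X'" "I = I'" "\<And>Z. Z \<in> I' \<Longrightarrow> v Z = v' Z"
  shows "graft X I v = graft X' I' v'"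
proof -
  have "(\<Pi>\<^sub>E Z\<in>I. Poly_Mapping.keys (v Z)) = (\<Pi>\<^sub>E Z\<in>I'. Poly_Mapping.keys (v' Z))"
    using assms by (auto simp: PiE_def Pi_def)
  then show ?thesis
    unfolding graft_def using assms by (auto intro!: sum.cong arg_cong2[where f = Poly_Mapping.single] prod.cong)
qed

function star :: "real \<Rightarrow> (hypergraph \<times> ctree) list \<Rightarrow> hypergraph \<Rightarrow> (ctree \<Rightarrow>\<^sub>0 real)" where
  "star q Cs H = (\<Sum>B | B \<noteq> {} \<and> B \<subseteq> {..<length Cs}. scal (q ^ (card B - 1))
     (graft (roots Cs B) (hg_components (delete H (roots Cs B)))
        (\<lambda>Z. star q (induced_constructs Cs B Z) (induce H Z))))"
  by pat_completeness auto
termination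
  by (relation "measure (\<lambda>(q, Cs, H). weight Cs)") (auto intro: weight_induced)

definition star_at :: "real \<Rightarrow> nat set \<Rightarrow> (hypergraph \<times> ctree) list \<Rightarrow> hypergraph \<Rightarrow> (ctree \<Rightarrow>\<^sub>0 real)" where
  "star_at q B Cs H = graft (roots Cs B) (hg_components (delete H (roots Cs B)))
     (\<lambda>Z. star q (induced_constructs Cs B Z) (induce H Z))"

text \<open>Delegations have at least one participant, so the value on \<open>[]\<close> plays no role.\<close>

function backslash :: "(hypergraph \<times> ctree) list \<Rightarrow> hypergraph \<Rightarrow> ctree" where
  "backslash Cs H = (if Cs = [] then undefined else
     plant (roots Cs {0}) (hg_components (delete H (roots Cs {0})))
       (\<lambda>Z. backslash (induced_constructs Cs {0} Z) (induce H Z)))"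
  by pat_completeness auto
termination
  by (relation "measure (\<lambda>(Cs, H). weight Cs)") (auto intro: weight_induced)

function slash :: "(hypergraph \<times> ctree) list \<Rightarrow> hypergraph \<Rightarrow> ctree" where
  "slash Cs H = (if Cs = [] then undefined else
     plant (roots Cs {length Cs - 1}) (hg_components (delete H (roots Cs {length Cs - 1})))
       (\<lambda>Z. slash (induced_constructs Cs {length Cs - 1} Z) (induce H Z)))"
  by pat_completeness auto
termination
  by (relation "measure (\<lambda>(Cs, H). weight Cs)") (auto intro: weight_induced)

text \<open>The unconditional recursion equations would make the simplifier loop.\<close>

declare star.simps [simp del] backslash.simps [simp del] slash.simps [simp del]
  construct_restrict.simps [simp del]

definition backslash_at :: "nat set \<Rightarrow> (hypergraph \<times> ctree) list \<Rightarrow> hypergraph \<Rightarrow> ctree" where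
  "backslash_at B Cs H = plant (roots Cs B) (hg_components (delete H (roots Cs B)))
     (\<lambda>Z. backslash (induced_constructs Cs B Z) (induce H Z))"

definition slash_at :: "nat set \<Rightarrow> (hypergraph \<times> ctree) list \<Rightarrow> hypergraph \<Rightarrow> ctree" where
  "slash_at B Cs H = plant (roots Cs B) (hg_components (delete H (roots Cs B)))
     (\<lambda>Z. slash (induced_constructs Cs B Z) (induce H Z))"

definition meeting :: "hypergraph list \<Rightarrow> int set \<Rightarrow> nat set" where
  "meeting Hs X = {b\<in>{..<length Hs}. X \<inter> \<Union>(Hs ! b) \<noteq> {}}"

text \<open>\<open>mu Hs U\<close> is \<open>\<mu>\<^sup>\<tau>(U)\<close>. It does not mention the coordinating hypergraph: the components of the
  latter minus the root of \<open>U\<close> are the vertex sets of the immediate subtrees of \<open>U\<close>.\<close>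

function mu :: "hypergraph list \<Rightarrow> ctree \<Rightarrow> nat" where
  "mu Hs (Node X us) = (card (meeting Hs X) - 1) +
     (\<Sum>u\<in>fset us. mu (induced_parts Hs (meeting Hs X) (\<lambda>b. X \<inter> \<Union>(Hs ! b)) (verts u)) u)"
  by pat_completeness auto
termination
  by (relation "measure (size \<circ> snd)") (use size_child in \<open>auto simp del: ctree.size\<close>)

declare mu.simps [simp del]

definition restricts_to :: "(hypergraph \<times> ctree) list \<Rightarrow> ctree \<Rightarrow> bool" where
  "restricts_to Cs U \<longleftrightarrow> (\<forall>(K, C)\<in>set Cs. construct_restrict U K = C)"

definition star_restr :: "real \<Rightarrow> (hypergraph \<times> ctree) list \<Rightarrow> hypergraph \<Rightarrow> (ctree \<Rightarrow>\<^sub>0 real)" where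
  "star_restr q Cs H = (\<Sum>U | construct H U \<and> restricts_to Cs U.
     Poly_Mapping.single U (q ^ mu (map fst Cs) U))"

text \<open>A tree \<open>U\<close> with root \<open>X\<^sub>B\<close> meets exactly the participants in \<open>B\<close> at its root, so
  \<open>card B \<le> mu (map fst Cs) U + 1\<close> and the subtraction in the exponent does not truncate. The
  trees in the interval of \<open>star_le_at\<close> all have this root.\<close>

definition star_restr_at :: "real \<Rightarrow> nat set \<Rightarrow> (hypergraph \<times> ctree) list \<Rightarrow> hypergraph \<Rightarrow> (ctree \<Rightarrow>\<^sub>0 real)" where
  "star_restr_at q B Cs H = (\<Sum>U | construct H U \<and> root_label U = roots Cs B \<and> restricts_to Cs U.
     Poly_Mapping.single U (q ^ (mu (map fst Cs) U + 1 - card B)))"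

definition star_le :: "real \<Rightarrow> (hypergraph \<times> ctree) list \<Rightarrow> hypergraph \<Rightarrow> (ctree \<Rightarrow>\<^sub>0 real)" where
  "star_le q Cs H = (\<Sum>U | construct H U \<and> flip_le H (slash Cs H) U \<and> flip_le H U (backslash Cs H).
     Poly_Mapping.single U (q ^ mu (map fst Cs) U))"

definition star_le_at :: "real \<Rightarrow> nat set \<Rightarrow> (hypergraph \<times> ctree) list \<Rightarrow> hypergraph \<Rightarrow> (ctree \<Rightarrow>\<^sub>0 real)" where
  "star_le_at q B Cs H =
     (\<Sum>U | construct H U \<and> flip_le H (slash_at B Cs H) U \<and> flip_le H U (backslash_at B Cs H).
        Poly_Mapping.single U (q ^ (mu (map fst Cs) U + 1 - card B)))"

end

(* A construct T is encoded by the map sending a connected set e to the part of e in the topmost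
   label of T that meets e. Restriction preserves these values, so U restricts to every C_a iff
   U and C_a agree on the connected subsets of H_a. Consequently U with root X_B restricts to the
   delegation iff its immediate subtrees restrict to the induced delegations; hence *(delta) and
   *_B(delta) are the sums over restrictions, the exponents of q adding up as in the recursive
   definition of mu.

   For the order: a step upwards either leaves the value at e unchanged or strictly decreases
   min + max of it. Since both ends of the interval restrict to the delegation, the values at
   connected subsets of H_a are constant on the interval. Conversely, if U restricts to the
   delegation, the root of C_1 can be pulled to the root of U by steps upwards, because H_1 < H_a
   for all other a; the resulting tree still restricts to the delegation, and induction on its
   subtrees leads up to the upper end. The lower end is reached in the same way with C_p. *)
theory Submission
  imports Defs
begin

section \<open>Components of hypergraphs\<close>

text \<open>Values at connected sets suit both sides of the theorem because a contraction is nearly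
  invisible to them: the value at \<open>e\<close> can change only if the parent label of the
  contracted edge is the first label to meet \<open>e\<close>, and then it just gains the child's
  share of \<open>e\<close>. Why min + max: let \<open>V < U\<close>. Merging a child
  \<open>V\<close> into \<open>U\<close> can lower the minimum of the value and keeps its maximum;
  splitting \<open>U \<union> V\<close> into \<open>V\<close> above \<open>U\<close> can lower the
  maximum and keeps the minimum. Neither quantity alone is strict for both kinds of step, their sum
  is. The obstacle to reaching the ends is that a root \<open>Y \<union> X\<close> cannot in general
  be split into \<open>Y\<close> above \<open>X\<close> by one step, since \<open>X\<close> may be
  spread over several components of \<open>H\<close> minus \<open>Y\<close>. Each component's share
  of \<open>X\<close> is split off separately, and every such step must compare this share with all
  that remains in the root. Hereditary ordering makes the components comparable; taking the most
  remote one first keeps all comparisons in the same direction.\<close>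

abbreviation comps :: "hypergraph \<Rightarrow> int set \<Rightarrow> int set set" where
  "comps H X \<equiv> hg_components (delete H X)"

section \<open>Induced hypergraphs and connected sets\<close>

lemma Union_induce: "hypergraph H \<Longrightarrow> X \<subseteq> \<Union>H \<Longrightarrow> \<Union>(induce H X) = X"
  unfolding hypergraph_def induce_def by blast

lemma hypergraph_induce: "hypergraph H \<Longrightarrow> hypergraph (induce H X)"
proof -
  assume H: "hypergraph H"
  have "\<Union>(induce H X) \<subseteq> \<Union>H" unfolding induce_def by blast
  then have "finite (\<Union>(induce H X))" using H unfolding hypergraph_def by (blast intro: finite_subset)
  moreover have "{x} \<in> induce H X" if "x \<in> \<Union>(induce H X)" for x
    using that H unfolding hypergraph_def induce_def by blast
  ultimately show ?thesis using H unfolding hypergraph_def induce_def by blast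
qed

lemma hypergraph_finite: "hypergraph H \<Longrightarrow> X \<subseteq> \<Union>H \<Longrightarrow> finite X"
  unfolding hypergraph_def using finite_subset by blast

text \<open>A hyperedge is non-empty, so it fails to cross a bipartition exactly when it lies within
  one side. The crossing form is the convenient one for unions.\<close>

lemma connected_in_iff:
  assumes H: "hypergraph H"
  shows "connected_in H X \<longleftrightarrow> X \<noteq> {} \<and> X \<subseteq> \<Union>H \<and>
    (\<forall>A B. A \<noteq> {} \<and> B \<noteq> {} \<and> A \<inter> B = {} \<and> A \<union> B = X \<longrightarrow>
       (\<exists>Z\<in>H. Z \<subseteq> X \<and> Z \<inter> A \<noteq> {} \<and> Z \<inter> B \<noteq> {}))"
proof (cases "X \<subseteq> \<Union>H")
  case True
  note U = Union_induce[OF H True]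
  have eq: "induce H X = induce (induce H X) A \<union> induce (induce H X) B \<longleftrightarrow>
      \<not> (\<exists>Z\<in>H. Z \<subseteq> X \<and> Z \<inter> A \<noteq> {} \<and> Z \<inter> B \<noteq> {})"
    if "A \<inter> B = {}" "A \<union> B = X" for A B
  proof -
    have *: "\<not> (Z \<inter> A \<noteq> {} \<and> Z \<inter> B \<noteq> {}) \<longleftrightarrow> Z \<subseteq> A \<or> Z \<subseteq> B" if "Z \<subseteq> X" "Z \<in> H" for Z
    proof -
      have "Z \<noteq> {}" using H that unfolding hypergraph_def by metis
      then show ?thesis using that \<open>A \<inter> B = {}\<close> \<open>A \<union> B = X\<close> by blast
    qed
    have "induce H X = induce (induce H X) A \<union> induce (induce H X) B \<longleftrightarrow>
        (\<forall>Z\<in>H. Z \<subseteq> X \<longrightarrow> Z \<subseteq> A \<or> Z \<subseteq> B)"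
      unfolding induce_def by auto
    then show ?thesis using * by meson
  qed
  \<comment> \<open>Naming the three conditions makes the remaining passage to quantifiers purely
    logical.\<close>
  define part where "part A B \<longleftrightarrow> A \<noteq> {} \<and> B \<noteq> {} \<and> A \<inter> B = {} \<and> A \<union> B = X" for A B
  define whole where "whole A B \<longleftrightarrow> induce H X = induce (induce H X) A \<union> induce (induce H X) B" for A B
  define across where "across A B \<longleftrightarrow> (\<exists>Z\<in>H. Z \<subseteq> X \<and> Z \<inter> A \<noteq> {} \<and> Z \<inter> B \<noteq> {})" for A B
  have "whole A B \<longleftrightarrow> \<not> across A B" if "part A B" for A B
    using eq[of A B] that unfolding part_def whole_def across_def by simp
  then have "\<not> (\<exists>A B. part A B \<and> whole A B) \<longleftrightarrow> (\<forall>A B. part A B \<longrightarrow> across A B)" by blast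
  then show ?thesis
    unfolding connected_in_def hg_connected_def U part_def whole_def across_def
    using True by (simp only: conj_assoc simp_thms)
qed (simp add: connected_in_def)

lemma connected_in_nonempty: "hypergraph H \<Longrightarrow> connected_in H X \<Longrightarrow> X \<noteq> {}"
  by (simp add: connected_in_iff)

lemma connected_in_subset: "connected_in H X \<Longrightarrow> X \<subseteq> \<Union>H"
  by (simp add: connected_in_def)

lemma connected_in_induce:
  assumes "hypergraph H" "Z \<subseteq> \<Union>H"
  shows "connected_in (induce H Z) e \<longleftrightarrow> connected_in H e \<and> e \<subseteq> Z"
proof -
  have "induce (induce H Z) e = induce H e" if "e \<subseteq> Z" using that unfolding induce_def by auto
  then show ?thesis
    unfolding connected_in_def Union_induce[OF assms] using assms(2) by auto
qed

lemma connected_in_delete: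
  assumes "hypergraph H"
  shows "connected_in (delete H X) e \<longleftrightarrow> connected_in H e \<and> e \<inter> X = {}"
  unfolding delete_def using connected_in_induce[OF assms, of "\<Union>H - X"] connected_in_subset[of H e]
  by auto

lemma induce_Union [simp]: "induce H (\<Union>H) = H"
  unfolding induce_def by auto

lemma hg_connected_iff: "hg_connected H \<longleftrightarrow> connected_in H (\<Union>H)"
  unfolding connected_in_def by simp

text \<open>A bipartition of the union must cut \<open>A\<close> or \<open>B\<close>, since a common
  point would otherwise draw both entirely to its own side. A hyperedge crossing within the piece
  that is cut also crosses the bipartition of the union.\<close>

lemma connected_in_Un:
  assumes H: "hypergraph H" and A: "connected_in H A" and B: "connected_in H B" and AB: "A \<inter> B \<noteq> {}"
  shows "connected_in H (A \<union> B)"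
proof -
  have key: "\<exists>Z\<in>H. Z \<subseteq> A \<union> B \<and> Z \<inter> P \<noteq> {} \<and> Z \<inter> Q \<noteq> {}"
    if conn: "connected_in H C" and C: "C \<subseteq> A \<union> B" "C \<inter> P \<noteq> {}" "C \<inter> Q \<noteq> {}"
      and PQ: "P \<inter> Q = {}" "P \<union> Q = A \<union> B" for P Q C
  proof -
    have "C \<inter> P \<noteq> {} \<and> C \<inter> Q \<noteq> {} \<and> (C \<inter> P) \<inter> (C \<inter> Q) = {} \<and> (C \<inter> P) \<union> (C \<inter> Q) = C"
      using C PQ by blast
    then obtain Z where "Z \<in> H" "Z \<subseteq> C" "Z \<inter> (C \<inter> P) \<noteq> {}" "Z \<inter> (C \<inter> Q) \<noteq> {}"
      using conn unfolding connected_in_iff[OF H] by meson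
    then show ?thesis using C by blast
  qed
  have "\<exists>Z\<in>H. Z \<subseteq> A \<union> B \<and> Z \<inter> P \<noteq> {} \<and> Z \<inter> Q \<noteq> {}"
    if "P \<noteq> {}" "Q \<noteq> {}" "P \<inter> Q = {}" "P \<union> Q = A \<union> B" for P Q
  proof -
    have "(A \<inter> P \<noteq> {} \<and> A \<inter> Q \<noteq> {}) \<or> (B \<inter> P \<noteq> {} \<and> B \<inter> Q \<noteq> {})"
    proof (rule ccontr)
      assume n: "\<not> ?thesis"
      obtain x where x: "x \<in> A" "x \<in> B" using AB by blast
      then have "x \<in> P \<or> x \<in> Q" using that by blast
      then show False
      proof
        assume "x \<in> P"
        then have "A \<inter> Q = {}" "B \<inter> Q = {}" using n x by blast+
        then show False using that by blast
      next
        assume "x \<in> Q"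
        then have "A \<inter> P = {}" "B \<inter> P = {}" using n x by blast+
        then show False using that by blast
      qed
    qed
    then show ?thesis using key[OF A, of P Q] key[OF B, of P Q] that by blast
  qed
  then show ?thesis using A B unfolding connected_in_iff[OF H] by auto
qed

lemma connected_in_singleton: "hypergraph H \<Longrightarrow> x \<in> \<Union>H \<Longrightarrow> connected_in H {x}"
proof -
  assume H: "hypergraph H" and x: "x \<in> \<Union>H"
  have "False" if "A \<noteq> {}" "B \<noteq> {}" "A \<inter> B = {}" "A \<union> B = {x}" for A B
  proof -
    have "A \<subseteq> {x}" "B \<subseteq> {x}" using that(4) by auto
    then have "A = {x}" "B = {x}" using that(1,2) subset_singletonD by metis+
    then show False using that(3) by simp
  qed
  then show ?thesis using x unfolding connected_in_iff[OF H] by blast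
qed

section \<open>Components as maximal connected sets avoiding the deleted vertices\<close>

lemma comps_iff:
  assumes "hypergraph H"
  shows "Z \<in> comps H X \<longleftrightarrow> connected_in H Z \<and> Z \<inter> X = {} \<and>
    (\<forall>Y. connected_in H Y \<and> Y \<inter> X = {} \<and> Z \<subseteq> Y \<longrightarrow> Y = Z)"
  unfolding hg_components_def using connected_in_delete[OF assms] by auto

lemma
  assumes "hypergraph H" "Z \<in> comps H X"
  shows comps_connected_in: "connected_in H Z"
    and comps_disjoint_deleted: "Z \<inter> X = {}"
    and comps_subset: "Z \<subseteq> \<Union>H"
    and comps_nonempty: "Z \<noteq> {}"
    and hypergraph_comp: "hypergraph (induce H Z)"
    and Union_comp: "\<Union>(induce H Z) = Z"
    and hg_connected_comp: "hg_connected (induce H Z)"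
proof -
  have Z: "connected_in H Z \<and> Z \<inter> X = {}" using assms(2) unfolding comps_iff[OF assms(1)] by blast
  then show 1: "connected_in H Z" "Z \<inter> X = {}" by blast+
  show 2: "Z \<subseteq> \<Union>H" by (rule connected_in_subset[OF 1(1)])
  show "Z \<noteq> {}" by (rule connected_in_nonempty[OF assms(1) 1(1)])
  show "hypergraph (induce H Z)" by (rule hypergraph_induce[OF assms(1)])
  show "\<Union>(induce H Z) = Z" by (rule Union_induce[OF assms(1) 2])
  show "hg_connected (induce H Z)" using 1(1) unfolding connected_in_def by blast
qed

lemma comp_containing:
  assumes H: "hypergraph H" and e: "connected_in H e" "e \<inter> X = {}"
  shows "\<exists>Z\<in>comps H X. e \<subseteq> Z"
proof -
  let ?F = "{Y. connected_in H Y \<and> Y \<inter> X = {}}"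
  have "?F \<subseteq> Pow (\<Union>H)" using connected_in_subset by blast
  then have "finite ?F" using H unfolding hypergraph_def by (meson finite_Pow_iff finite_subset)
  from finite_has_maximal2[OF this, of e] e
  obtain Z where Z: "Z \<in> ?F" "e \<subseteq> Z" "\<forall>Y\<in>?F. Z \<le> Y \<longrightarrow> Z = Y" by auto
  have "Z \<in> comps H X" unfolding comps_iff[OF H] using Z(1,3) by auto
  then show ?thesis using Z(2) by blast
qed

lemma comps_eqI:
  assumes H: "hypergraph H" and Z: "Z \<in> comps H X" and Z': "Z' \<in> comps H X" and "Z \<inter> Z' \<noteq> {}"
  shows "Z = Z'"
proof -
  have "connected_in H (Z \<union> Z')" using connected_in_Un assms comps_connected_in by metis
  moreover have "(Z \<union> Z') \<inter> X = {}" using comps_disjoint_deleted[OF H] Z Z' by blast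
  ultimately have "Z \<union> Z' = Z" "Z \<union> Z' = Z'" using Z Z' unfolding comps_iff[OF H] by blast+
  then show ?thesis by blast
qed

lemma connected_subset_comp:
  assumes H: "hypergraph H" and Z: "Z \<in> comps H X" and e: "connected_in H e" "e \<inter> X = {}"
    and "e \<inter> Z \<noteq> {}"
  shows "e \<subseteq> Z"
proof -
  obtain Z' where Z': "Z' \<in> comps H X" "e \<subseteq> Z'" using comp_containing[OF H e] by blast
  then have "Z = Z'" using comps_eqI[OF H Z Z'(1)] assms(5) by blast
  then show ?thesis using Z' by simp
qed

lemma Union_comps: "hypergraph H \<Longrightarrow> \<Union>(comps H X) = \<Union>H - X"
proof (intro equalityI subsetI)
  fix x assume H: "hypergraph H" and x: "x \<in> \<Union>H - X"
  have "connected_in H {x}" using connected_in_singleton[OF H] x by blast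
  from comp_containing[OF H this] x show "x \<in> \<Union>(comps H X)" by blast
next
  fix x assume H: "hypergraph H" and x: "x \<in> \<Union>(comps H X)"
  then show "x \<in> \<Union>H - X" using comps_subset[OF H] comps_disjoint_deleted[OF H] by blast
qed

lemma finite_comps: "hypergraph H \<Longrightarrow> finite (comps H X)"
proof -
  assume H: "hypergraph H"
  have "comps H X \<subseteq> Pow (\<Union>H)" using comps_subset[OF H] by blast
  then show ?thesis using H unfolding hypergraph_def by (meson finite_Pow_iff finite_subset)
qed

lemma comps_all: "hypergraph H \<Longrightarrow> comps H (\<Union>H) = {}"
  using Union_comps[of H "\<Union>H"] comps_nonempty[of H _ "\<Union>H"] by blast

text \<open>Deleting more vertices only removes competitors for maximality.\<close>

lemma comps_mono_deleted:
  assumes H: "hypergraph H" and Z: "Z \<in> comps H Y" and "Y \<subseteq> W" "Z \<inter> W = {}"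
  shows "Z \<in> comps H W"
proof -
  have "Y' = Z" if "connected_in H Y'" "Y' \<inter> W = {}" "Z \<subseteq> Y'" for Y'
  proof -
    have "Y' \<inter> Y = {}" using that assms by blast
    then show ?thesis using Z that unfolding comps_iff[OF H] by blast
  qed
  then show ?thesis using Z assms(4) unfolding comps_iff[OF H] by blast
qed

text \<open>The bookkeeping behind an edge contraction: if \<open>W\<close> is a label and
  \<open>Q\<close> that of its child on \<open>Z\<close>, the right-hand side indexes the subtrees
  that hang below the merged node. A connected set that avoids \<open>W\<close> and meets
  \<open>Z\<close> stays inside \<open>Z\<close>, so maximality can be tested locally.\<close>

lemma comps_Un:
  assumes H: "hypergraph H" and Z: "Z \<in> comps H W" and Q: "Q \<subseteq> Z"
  shows "comps H (W \<union> Q) = (comps H W - {Z}) \<union> comps (induce H Z) Q"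
proof (intro equalityI subsetI)
  note Zs = comps_subset[OF H Z] and HZ = hypergraph_comp[OF H Z]
  note cZ = connected_in_induce[OF H Zs]
  fix C assume C: "C \<in> comps H (W \<union> Q)"
  have CW: "connected_in H C" "C \<inter> W = {}" "C \<inter> Q = {}" using C unfolding comps_iff[OF H] by blast+
  then obtain Z' where Z': "Z' \<in> comps H W" "C \<subseteq> Z'" using comp_containing[OF H] by blast
  show "C \<in> (comps H W - {Z}) \<union> comps (induce H Z) Q"
  proof (cases "Z' = Z")
    case True
    have "Y = C" if "connected_in H Y" "Y \<subseteq> Z" "Y \<inter> Q = {}" "C \<subseteq> Y" for Y
    proof -
      have "Y \<inter> (W \<union> Q) = {}" using that comps_disjoint_deleted[OF H Z] by blast
      then show ?thesis using C that unfolding comps_iff[OF H] by blast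
    qed
    then have "C \<in> comps (induce H Z) Q"
      unfolding comps_iff[OF HZ] cZ using CW Z' True by blast
    then show ?thesis by blast
  next
    case False
    then have "Z' \<inter> Z = {}" using comps_eqI[OF H Z'(1) Z] by blast
    then have "Z' \<inter> (W \<union> Q) = {}" using Q comps_disjoint_deleted[OF H Z'(1)] by blast
    then have "Z' = C" using C Z' comps_connected_in[OF H Z'(1)] unfolding comps_iff[OF H] by blast
    then show ?thesis using Z' False by blast
  qed
next
  note Zs = comps_subset[OF H Z] and HZ = hypergraph_comp[OF H Z]
  note cZ = connected_in_induce[OF H Zs]
  fix C assume "C \<in> (comps H W - {Z}) \<union> comps (induce H Z) Q"
  then show "C \<in> comps H (W \<union> Q)"
  proof
    assume C: "C \<in> comps H W - {Z}"
    then have "C \<inter> Z = {}" using comps_eqI[OF H _ Z] by blast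
    then have "C \<inter> (W \<union> Q) = {}" using Q comps_disjoint_deleted[OF H] C by blast
    then show ?thesis using comps_mono_deleted[OF H, of C W] C by blast
  next
    assume C: "C \<in> comps (induce H Z) Q"
    then have C': "connected_in H C" "C \<subseteq> Z" "C \<inter> Q = {}" unfolding comps_iff[OF HZ] cZ by blast+
    have "Y = C" if "connected_in H Y" "Y \<inter> (W \<union> Q) = {}" "C \<subseteq> Y" for Y
    proof -
      have "Y \<inter> Z \<noteq> {}" using that C' connected_in_nonempty[OF H C'(1)] by blast
      then have "Y \<subseteq> Z" using connected_subset_comp[OF H Z that(1)] that by blast
      then show ?thesis using C that unfolding comps_iff[OF HZ] cZ by blast
    qed
    moreover have "C \<inter> (W \<union> Q) = {}" using C' comps_disjoint_deleted[OF H Z] by blast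
    ultimately show ?thesis using C' unfolding comps_iff[OF H] by blast
  qed
qed

section \<open>Constructs and restrictions\<close>

lemma root_label_plant [simp]: "root_label (plant X I T) = X"
  by (simp add: plant_def)

lemma children_plant: "finite I \<Longrightarrow> fset (children (plant X I T)) = T ` I"
  by (simp add: plant_def Abs_fset_inverse)

lemma plant_empty: "plant X {} T = Node X {||}"
  by (simp add: plant_def bot_fset_def)

lemma verts_plant: "finite I \<Longrightarrow> verts (plant X I T) = X \<union> (\<Union>Z\<in>I. verts (T Z))"
  by (simp add: plant_def Abs_fset_inverse)

lemma construct_plantI:
  assumes H: "hypergraph H" "hg_connected H" and Y: "Y \<noteq> {}" "Y \<subseteq> \<Union>H"
    and T: "\<And>Z. Z \<in> comps H Y \<Longrightarrow> construct (induce H Z) (T Z)"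
  shows "construct H (plant Y (comps H Y) T)"
proof (cases "Y = \<Union>H")
  case True
  then show ?thesis using construct.whole[OF H] by (simp add: comps_all[OF H(1)] plant_empty)
next
  case False
  then show ?thesis using assms construct.plant by blast
qed

text \<open>The one-node tree is \<open>plant\<close> over the empty set of components, with
  \<open>Y = \<Union>H\<close>. Absorbing it leaves a single case in all later inductions.\<close>

lemma construct_induct [consumes 1, case_names plant]:
  assumes "construct H S"
    and "\<And>H Y T. hypergraph H \<Longrightarrow> hg_connected H \<Longrightarrow> Y \<noteq> {} \<Longrightarrow> Y \<subseteq> \<Union>H \<Longrightarrow>
      (\<And>Z. Z \<in> comps H Y \<Longrightarrow> construct (induce H Z) (T Z)) \<Longrightarrow>
      (\<And>Z. Z \<in> comps H Y \<Longrightarrow> P (induce H Z) (T Z)) \<Longrightarrow> P H (plant Y (comps H Y) T)"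
  shows "P H S"
  using assms(1)
proof induction
  case (whole H)
  have "P H (plant (\<Union>H) (comps H (\<Union>H)) (\<lambda>_. undefined))"
    by (rule assms(2)) (use whole in \<open>auto simp: comps_all hg_connected_def\<close>)
  then show ?case by (simp add: comps_all[OF whole(1)] plant_empty)
next
  case (plant H Y T)
  then show ?case by (intro assms(2)) auto
qed

lemma construct_cases [consumes 1, case_names plant]:
  assumes "construct H S"
  obtains Y T where "S = plant Y (comps H Y) T" "hypergraph H" "hg_connected H" "Y \<noteq> {}" "Y \<subseteq> \<Union>H"
    "\<And>Z. Z \<in> comps H Y \<Longrightarrow> construct (induce H Z) (T Z)"
  using assms by (induction rule: construct_induct) blast

lemma
  assumes "construct H S"
  shows construct_hypergraph: "hypergraph H" and construct_hg_connected: "hg_connected H"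
  using assms by (auto elim: construct_cases)

lemma verts_construct: "construct H S \<Longrightarrow> verts S = \<Union>H"
proof (induction rule: construct_induct)
  case (plant H Y T)
  have "(\<Union>Z\<in>comps H Y. verts (T Z)) = \<Union>(comps H Y)"
    using plant(6) Union_comp[OF plant(1)] by simp
  then show ?case
    unfolding verts_plant[OF finite_comps[OF plant(1)]] using Union_comps[OF plant(1), of Y] plant(4) by auto
qed

lemma verts_comp: "hypergraph H \<Longrightarrow> Z \<in> comps H Y \<Longrightarrow> construct (induce H Z) S \<Longrightarrow> verts S = Z"
  using verts_construct Union_comp by simp

text \<open>For a set \<open>e\<close> connected in the hypergraph underlying \<open>T\<close>, this is the intersection of \<open>e\<close> with
  the topmost label meeting \<open>e\<close>. A construct is determined by these values, and restriction
  preserves them.\<close>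

primrec top_part :: "ctree \<Rightarrow> int set \<Rightarrow> int set" where
  "top_part (Node X cs) =
     (\<lambda>e. if X \<inter> e \<noteq> {} then X \<inter> e else \<Union> ((\<lambda>f. f e) ` fset (top_part |`| cs)))"

lemma top_part_Node:
  "top_part (Node X cs) e = (if X \<inter> e \<noteq> {} then X \<inter> e else (\<Union>c\<in>fset cs. top_part c e))"
  by simp

declare top_part.simps [simp del]

lemma top_part_plant:
  "finite I \<Longrightarrow> top_part (plant X I T) e = (if X \<inter> e \<noteq> {} then X \<inter> e else (\<Union>Z\<in>I. top_part (T Z) e))"
  unfolding plant_def top_part_Node by (simp add: Abs_fset_inverse)

lemma top_part_subset: "top_part T e \<subseteq> e \<inter> verts T"
proof (induction T)
  case (Node X cs)
  have "(\<Union>c\<in>fset cs. top_part c e) \<subseteq> e \<inter> (\<Union>c\<in>fset cs. verts c)" using Node by blast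
  then show ?case unfolding top_part_Node by auto
qed

lemma top_part_nonempty: "e \<inter> verts T \<noteq> {} \<Longrightarrow> top_part T e \<noteq> {}"
proof (induction T)
  case (Node X cs)
  show ?case
  proof (cases "X \<inter> e = {}")
    case True
    then obtain c where "c \<in> fset cs" "e \<inter> verts c \<noteq> {}" using Node.prems by auto
    then show ?thesis using Node.IH[of c] True unfolding top_part_Node by auto
  qed (simp add: top_part_Node)
qed

text \<open>The subtrees on the other components contribute empty values, because their vertices
  miss \<open>e\<close>.\<close>

lemma top_part_comp:
  assumes H: "hypergraph H" and Z: "Z \<in> comps H Y" "e \<subseteq> Z"
    and T: "\<And>Z. Z \<in> comps H Y \<Longrightarrow> construct (induce H Z) (T Z)"
  shows "top_part (plant Y (comps H Y) T) e = top_part (T Z) e"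
proof -
  have Y: "Y \<inter> e = {}" using comps_disjoint_deleted[OF H Z(1)] Z(2) by blast
  have "top_part (T Z') e = {}" if "Z' \<in> comps H Y" "Z' \<noteq> Z" for Z'
  proof -
    have "e \<inter> Z' = {}" using comps_eqI[OF H that(1) Z(1)] that(2) Z(2) by blast
    then show ?thesis using top_part_subset[of "T Z'" e] verts_comp[OF H that(1) T[OF that(1)]] by simp
  qed
  then have "(\<Union>Z'\<in>comps H Y. top_part (T Z') e) = top_part (T Z) e" using Z(1) by auto
  then show ?thesis using Y by (simp add: top_part_plant[OF finite_comps[OF H]])
qed

text \<open>The root is the first label to meet the full vertex set, so it can be read off from the
  values.\<close>

lemma top_part_whole:
  assumes "construct H S"
  shows "top_part S (\<Union>H) = root_label S"
  using assms
proof (cases rule: construct_cases)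
  case (plant Y T)
  then show ?thesis by (auto simp: top_part_plant[OF finite_comps])
qed

text \<open>The value at \<open>\<Union>H\<close> gives the root, hence the components below it; the
  values at connected sets inside a component are those of the subtree there.\<close>

lemma construct_eqI:
  assumes "construct K S" "construct K S'" "\<And>e. connected_in K e \<Longrightarrow> top_part S e = top_part S' e"
  shows "S = S'"
  using assms
proof (induction arbitrary: S' rule: construct_induct)
  case (plant H Y T)
  have c: "construct H (plant Y (comps H Y) T)" by (rule construct_plantI) (use plant in auto)
  from plant.prems(1) obtain Y' T' where S': "S' = plant Y' (comps H Y') T'"
    "\<And>Z. Z \<in> comps H Y' \<Longrightarrow> construct (induce H Z) (T' Z)"
    by (elim construct_cases) metis
  have "connected_in H (\<Union>H)" using plant(2) hg_connected_iff by blast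
  then have "top_part (plant Y (comps H Y) T) (\<Union>H) = top_part S' (\<Union>H)" by (rule plant.prems(2))
  then have Y': "Y' = Y"
    using top_part_whole[OF c] top_part_whole[OF plant.prems(1)] by (simp add: S'(1))
  note T' = S'(2)[unfolded Y']
  have "T Z = T' Z" if Z: "Z \<in> comps H Y" for Z
  proof (rule plant(6)[OF Z T'[OF Z]])
    fix e assume "connected_in (induce H Z) e"
    then have e: "connected_in H e" "e \<subseteq> Z"
      using connected_in_induce[OF plant(1) comps_subset[OF plant(1) Z]] by auto
    show "top_part (T Z) e = top_part (T' Z) e"
      using plant.prems(2)[OF e(1)] top_part_comp[OF plant(1) Z e(2) plant(5)]
        top_part_comp[OF plant(1) Z e(2) T'] by (simp add: S' Y')
  qed
  then show ?case unfolding S'(1) Y' by (intro plant_cong) auto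
qed

text \<open>Both claims are proved together, since the values of a restricted subtree are computed
  with \<open>top_part_comp\<close>, which needs the subtrees to be constructs.\<close>

lemma construct_restrict_properties:
  assumes "construct H U" "hypergraph K" "hg_connected K"
    and "\<And>e. connected_in K e \<Longrightarrow> connected_in H e"
  shows "construct K (construct_restrict U K) \<and>
    (\<forall>e. connected_in K e \<longrightarrow> top_part (construct_restrict U K) e = top_part U e)"
  using assms
proof (induction arbitrary: K rule: construct_induct)
  case (plant H Y T)
  note H = plant(1) and T = plant(5) and K = plant.prems(1) and KH = plant.prems(3)
  have fin: "finite (comps H Y)" by (rule finite_comps[OF H])
  define cs where "cs = Abs_fset (T ` comps H Y)"
  have cs: "fset cs = T ` comps H Y" using fin by (simp add: cs_def Abs_fset_inverse)
  have U: "plant Y (comps H Y) T = Node Y cs" by (simp add: plant_def cs_def)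
  have Kc: "connected_in K (\<Union>K)" using plant.prems(2) hg_connected_iff by blast
  have conn: "connected_in (induce H Z) e" if "connected_in K e" "e \<subseteq> Z" "Z \<in> comps H Y" for Z e
    using KH[OF that(1)] that(2,3) connected_in_induce[OF H comps_subset[OF H]] by blast
  have vT: "verts (T Z) = Z" if "Z \<in> comps H Y" for Z
    using verts_comp[OF H that T[OF that]] .
  have uniq: "Z' = Z" if "Z \<in> comps H Y" "Z' \<in> comps H Y" "e \<subseteq> Z" "e \<subseteq> Z'" "e \<noteq> {}" for Z Z' e
    using comps_eqI[OF H that(2,1)] that(3-5) by blast
  \<comment> \<open>These are the branches of \<open>construct_restrict\<close>: there are no
    components exactly when the node has no children.\<close>
  consider (leaf) "comps H Y = {}" | (off) "comps H Y \<noteq> {}" "Y \<inter> \<Union>K = {}"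
    | (on) "comps H Y \<noteq> {}" "Y \<inter> \<Union>K \<noteq> {}" by blast
  then show ?case
  proof cases
    case leaf
    have Y: "Y = \<Union>H" using Union_comps[OF H, of Y] leaf plant(4) by auto
    have "cs = {||}" using cs leaf by auto
    then have r: "construct_restrict (plant Y (comps H Y) T) K = Node (\<Union>K) {||}"
      unfolding U by (simp add: construct_restrict.simps)
    have "top_part (Node (\<Union>K) {||}) e = top_part (plant Y (comps H Y) T) e" if "connected_in K e" for e
    proof -
      have "e \<noteq> {}" "e \<subseteq> \<Union>K" "e \<subseteq> \<Union>H"
        using connected_in_nonempty[OF K that] connected_in_subset that KH by blast+
      then have "\<Union>K \<inter> e = e" "\<Union>H \<inter> e = e" "e \<noteq> {}" by blast+
      then show ?thesis using leaf Y by (simp add: top_part_Node top_part_plant)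
    qed
    then show ?thesis unfolding r using construct.whole[OF K plant.prems(2)] by blast
  next
    case off
    have "cs \<noteq> {||}" using cs off(1) by auto
    obtain Z where Z: "Z \<in> comps H Y" "\<Union>K \<subseteq> Z"
      using comp_containing[OF H KH[OF Kc], of Y] off(2) by blast
    have "(THE D. \<exists>c\<in>fset cs. \<Union>K \<subseteq> verts c \<and> D = construct_restrict c K) = construct_restrict (T Z) K"
    proof (rule the_equality)
      show "\<exists>c\<in>fset cs. \<Union>K \<subseteq> verts c \<and> construct_restrict (T Z) K = construct_restrict c K"
        using Z vT cs by auto
      fix D assume "\<exists>c\<in>fset cs. \<Union>K \<subseteq> verts c \<and> D = construct_restrict c K"
      then obtain Z' where "Z' \<in> comps H Y" "\<Union>K \<subseteq> Z'" "D = construct_restrict (T Z') K"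
        using cs vT by auto
      then show "D = construct_restrict (T Z) K"
        using uniq[OF Z(1) _ Z(2)] connected_in_nonempty[OF K Kc] by blast
    qed
    then have r: "construct_restrict (plant Y (comps H Y) T) K = construct_restrict (T Z) K"
      unfolding U using \<open>cs \<noteq> {||}\<close> off(2) by (subst construct_restrict.simps) simp
    have "construct K (construct_restrict (T Z) K) \<and>
        (\<forall>e. connected_in K e \<longrightarrow> top_part (construct_restrict (T Z) K) e = top_part (T Z) e)"
    proof (rule plant(6)[OF Z(1) K plant.prems(2)])
      fix e assume e: "connected_in K e"
      show "connected_in (induce H Z) e"
        by (rule conn[OF e _ Z(1)]) (use connected_in_subset[OF e] Z(2) in blast)
    qed
    moreover have "top_part (plant Y (comps H Y) T) e = top_part (T Z) e" if "connected_in K e" for e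
    proof -
      have "e \<subseteq> Z" using connected_in_subset[OF that] Z(2) by blast
      then show ?thesis using top_part_comp[OF H Z(1) _ T] by blast
    qed
    ultimately show ?thesis unfolding r by simp
  next
    case on
    have "cs \<noteq> {||}" using cs on(1) by auto
    let ?X = "Y \<inter> \<Union>K"
    have "\<exists>Z\<in>comps H Y. Z' \<subseteq> Z" if "Z' \<in> comps K ?X" for Z'
    proof (rule comp_containing[OF H KH[OF comps_connected_in[OF K that]]])
      show "Z' \<inter> Y = {}" using comps_disjoint_deleted[OF K that] comps_subset[OF K that] by blast
    qed
    \<comment> \<open>\<open>f\<close> is the index map written psi in the definition of
      restriction: it sends a component of \<open>K\<close> minus \<open>?X\<close> to the component
      of \<open>H\<close> minus \<open>Y\<close> around it.\<close>
    then obtain f where f: "\<And>Z'. Z' \<in> comps K ?X \<Longrightarrow> f Z' \<in> comps H Y \<and> Z' \<subseteq> f Z'" by metis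
    define R where "R Z' = construct_restrict (T (f Z')) (induce K Z')" for Z'
    have "{D. \<exists>Z\<in>comps K ?X. \<exists>c\<in>fset cs. Z \<subseteq> verts c \<and> D = construct_restrict c (induce K Z)} =
        R ` comps K ?X" (is "?L = _")
    proof (intro equalityI subsetI)
      fix D assume "D \<in> ?L"
      then obtain Z Z' where D: "Z \<in> comps K ?X" "Z' \<in> comps H Y" "Z \<subseteq> Z'"
        "D = construct_restrict (T Z') (induce K Z)"
        using cs vT by auto
      have "Z' = f Z" using uniq[of "f Z" Z' Z] f[OF D(1)] D comps_nonempty[OF K D(1)] by blast
      then show "D \<in> R ` comps K ?X" using D by (auto simp: R_def)
    next
      fix D assume "D \<in> R ` comps K ?X"
      then obtain Z where D: "Z \<in> comps K ?X" "D = R Z" by blast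
      have "T (f Z) \<in> fset cs" "Z \<subseteq> verts (T (f Z))" using f[OF D(1)] cs vT by auto
      then show "D \<in> ?L" using D unfolding R_def by blast
    qed
    then have r: "construct_restrict (plant Y (comps H Y) T) K = plant ?X (comps K ?X) R"
      unfolding U using \<open>cs \<noteq> {||}\<close> on(2) by (subst construct_restrict.simps) (simp add: plant_def)
    have IH: "construct (induce K Z) (R Z) \<and>
        (\<forall>e. connected_in (induce K Z) e \<longrightarrow> top_part (R Z) e = top_part (T (f Z)) e)"
      if Z: "Z \<in> comps K ?X" for Z
      unfolding R_def
    proof (rule plant(6))
      show "f Z \<in> comps H Y" using f[OF Z] by blast
      show "hypergraph (induce K Z)" "hg_connected (induce K Z)"
        using hypergraph_comp[OF K Z] hg_connected_comp[OF K Z] .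
      fix e assume "connected_in (induce K Z) e"
      then have "connected_in K e" "e \<subseteq> Z"
        using connected_in_induce[OF K comps_subset[OF K Z]] by blast+
      then show "connected_in (induce H (f Z)) e" using conn[of e "f Z"] f[OF Z] by blast
    qed
    have "construct K (plant ?X (comps K ?X) R)"
      by (rule construct_plantI[OF K plant.prems(2) on(2)]) (use IH in auto)
    moreover have "top_part (plant ?X (comps K ?X) R) e = top_part (plant Y (comps H Y) T) e"
      if e: "connected_in K e" for e
    proof (cases "Y \<inter> e = {}")
      case False
      moreover have "?X \<inter> e = Y \<inter> e" using connected_in_subset[OF e] by blast
      ultimately show ?thesis by (simp add: top_part_plant[OF fin] top_part_plant[OF finite_comps[OF K]])
    next
      case True
      then obtain Z where Z: "Z \<in> comps K ?X" "e \<subseteq> Z" using comp_containing[OF K e, of ?X] by blast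
      have ec: "connected_in (induce K Z) e"
        using connected_in_induce[OF K comps_subset[OF K Z(1)]] e Z(2) by blast
      have "e \<subseteq> f Z" using f[OF Z(1)] Z(2) by blast
      then have "top_part (plant Y (comps H Y) T) e = top_part (T (f Z)) e"
        using top_part_comp[OF H _ _ T] f[OF Z(1)] by blast
      moreover have "top_part (plant ?X (comps K ?X) R) e = top_part (R Z) e"
        by (rule top_part_comp[OF K Z]) (use IH in blast)
      ultimately show ?thesis using IH[OF Z(1)] ec by simp
    qed
    ultimately show ?thesis unfolding r by blast
  qed
qed

text \<open>This removes the recursion of \<open>construct_restrict\<close> from the argument;
  afterwards only values are compared.\<close>

lemma construct_restrict_eq_iff:
  assumes "construct H U" "construct K C" "\<And>e. connected_in K e \<Longrightarrow> connected_in H e"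
  shows "construct_restrict U K = C \<longleftrightarrow> (\<forall>e. connected_in K e \<longrightarrow> top_part U e = top_part C e)"
proof -
  have r: "construct K (construct_restrict U K)"
    "\<And>e. connected_in K e \<Longrightarrow> top_part (construct_restrict U K) e = top_part U e"
    using construct_restrict_properties[OF assms(1) construct_hypergraph[OF assms(2)]
        construct_hg_connected[OF assms(2)] assms(3)] by blast+
  then show ?thesis using construct_eqI[OF r(1) assms(2)] by auto
qed

section \<open>Contractions and flips\<close>

lemma contracts_verts: "contracts P Q S T \<Longrightarrow> verts T = verts S"
proof (induction rule: contracts.induct)
  case (here ds cs)
  then have "(\<Union>c\<in>fset cs. verts c) = (\<Union>c\<in>fset cs - {Node Q ds}. verts c) \<union> verts (Node Q ds)" by blast
  then show ?case by auto
next
  case (below c cs d Z)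
  then have "(\<Union>c\<in>fset cs. verts c) = (\<Union>c\<in>fset cs - {c}. verts c) \<union> verts c" by blast
  then show ?case using below by auto
qed

lemma contracts_labels: "contracts P Q S T \<Longrightarrow> P \<union> Q \<subseteq> verts S"
proof (induction rule: contracts.induct)
  case (here ds cs)
  then have "Q \<subseteq> (\<Union>c\<in>fset cs. verts c)" by fastforce
  then show ?case by auto
next
  case (below c cs d Z)
  then show ?case by auto
qed

text \<open>\<open>contracts\<close> speaks of \<open>Node\<close> and a finite set of children,
  constructs of \<open>plant\<close> and a family over components. This passes from the first view
  to the second.\<close>

lemma children_construct:
  assumes "construct H (Node X cs)"
  obtains T where "fset cs = T ` comps H X" "hypergraph H" "X \<subseteq> \<Union>H"
    "\<And>Z. Z \<in> comps H X \<Longrightarrow> construct (induce H Z) (T Z)"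
  using assms
proof (cases rule: construct_cases)
  case (plant Y T)
  then have "X = Y" "fset cs = T ` comps H Y"
    using root_label_plant[of Y "comps H Y" T] children_plant[OF finite_comps[of H Y], where T = T] by (metis ctree.sel)+
  then show ?thesis using that plant by blast
qed

lemma child_verts_disjoint:
  assumes "construct H (Node X cs)" "c \<in> fset cs" "connected_in H e" "X \<inter> e = {}" "e \<inter> verts c \<noteq> {}"
  shows "e \<subseteq> verts c \<and> connected_in (induce H (verts c)) e \<and> construct (induce H (verts c)) c \<and>
    (\<forall>c'\<in>fset cs - {c}. top_part c' e = {})"
proof -
  obtain T where T: "fset cs = T ` comps H X" "hypergraph H"
    "\<And>Z. Z \<in> comps H X \<Longrightarrow> construct (induce H Z) (T Z)"
    using children_construct[OF assms(1)] by metis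
  obtain Z where Z: "Z \<in> comps H X" "c = T Z" using T(1) assms(2) by blast
  have v: "verts (T Z') = Z'" if "Z' \<in> comps H X" for Z' using verts_comp[OF T(2) that T(3)[OF that]] .
  have e: "e \<subseteq> Z" by (rule connected_subset_comp[OF T(2) Z(1) assms(3)]) (use assms Z v in auto)
  have "top_part c' e = {}" if "c' \<in> fset cs - {c}" for c'
  proof -
    obtain Z' where Z': "Z' \<in> comps H X" "c' = T Z'" using T(1) \<open>c' \<in> _\<close> by blast
    then have "Z' \<noteq> Z" using that Z by blast
    then have "Z' \<inter> e = {}" using comps_eqI[OF T(2) Z'(1) Z(1)] e by blast
    then show ?thesis using top_part_subset[of c' e] v[OF Z'(1)] Z'(2) by auto
  qed
  then show ?thesis
    using e connected_in_induce[OF T(2) comps_subset[OF T(2) Z(1)]] assms(3) T(3)[OF Z(1)] v[OF Z(1)] Z(2) by simp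
qed

text \<open>If \<open>P\<close> misses \<open>e\<close>, merging it with \<open>Q\<close> does not
  change the share of \<open>e\<close> in any label, and a connected \<open>e\<close> lies below
  only one child of \<open>P\<close>. So a change requires that \<open>P\<close> is the first label
  to meet \<open>e\<close>.\<close>

lemma contracts_top_part:
  assumes "contracts P Q S T" "construct H S" "connected_in H e"
  shows "top_part T e = top_part S e \<or>
    (P \<inter> e \<noteq> {} \<and> top_part S e = P \<inter> e \<and> top_part T e = (P \<union> Q) \<inter> e)"
  using assms
proof (induction arbitrary: H rule: contracts.induct)
  case (here ds cs)
  let ?n = "Node Q ds"
  let ?rest = "\<Union>c\<in>fset cs - {?n}. top_part c e"
  show ?case
  proof (cases "P \<inter> e = {}")
    case False
    then show ?thesis by (auto simp: top_part_Node)
  next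
    case P: True
    have S: "top_part (Node P cs) e = ?rest \<union> top_part ?n e"
      using here.hyps P by (auto simp: top_part_Node[of P])
    show ?thesis
    proof (cases "Q \<inter> e = {}")
      case True
      then have "(P \<union> Q) \<inter> e = {}" using P by blast
      then show ?thesis using True unfolding S by (simp add: top_part_Node[of "P \<union> Q"] top_part_Node[of Q] UN_Un)
    next
      case False
      \<comment> \<open>Here \<open>Q\<close> is the first label to meet \<open>e\<close>: the
        siblings contribute nothing, and both values are \<open>Q \<inter> e\<close>.\<close>
      then have "e \<inter> verts ?n \<noteq> {}" by auto
      from child_verts_disjoint[OF here.prems(1) _ here.prems(2) P this] here.hyps
      have "?rest = {}" by auto
      moreover have "(P \<union> Q) \<inter> e = Q \<inter> e" using P by blast
      ultimately show ?thesis using False unfolding S by (simp add: top_part_Node[of "P \<union> Q"] top_part_Node[of Q])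
    qed
  qed
next
  case (below c cs d Z)
  let ?rest = "\<Union>c\<in>fset cs - {c}. top_part c e"
  show ?case
  proof (cases "Z \<inter> e = {}")
    case False
    then show ?thesis by (auto simp: top_part_Node)
  next
    case True
    have S: "top_part (Node Z cs) e = top_part c e \<union> ?rest"
      using below.hyps True by (auto simp: top_part_Node[of Z])
    have T: "top_part (Node Z (finsert d (cs |-| {|c|}))) e = top_part d e \<union> ?rest"
      using True by (simp add: top_part_Node[of Z])
    show ?thesis
    proof (cases "e \<inter> verts c = {}")
      case True
      then have "top_part c e = {}" "top_part d e = {}"
        using top_part_subset[of c e] top_part_subset[of d e] contracts_verts[OF below.hyps(2)] by auto
      then show ?thesis unfolding S T by simp
    next
      case False
      from child_verts_disjoint[OF below.prems(1) _ below.prems(2) True this] below.hyps(1)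
      have *: "connected_in (induce H (verts c)) e" "construct (induce H (verts c)) c" "?rest = {}" by auto
      show ?thesis using below.IH[OF *(2,1)] unfolding S T *(3) by simp
    qed
  qed
qed

text \<open>With \<open>B\<close> below \<open>A\<close>, the union has the minimum of
  \<open>B\<close> and the maximum of \<open>A\<close>. The two inequalities serve contracting and
  splitting steps respectively.\<close>

lemma Min_add_Max_merge:
  fixes A B :: "int set"
  assumes "finite A" "finite B" "A \<noteq> {}" "B \<noteq> {}" "\<And>a b. a \<in> A \<Longrightarrow> b \<in> B \<Longrightarrow> b < a"
  shows "Min (A \<union> B) + Max (A \<union> B) < Min A + Max A"
    and "Min B + Max B < Min (A \<union> B) + Max (A \<union> B)"
proof -
  have "Max B < Min A" using assms by simp
  moreover have "Min B \<le> Max B" "Min A \<le> Max A" using assms by simp_all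
  moreover have "Min (A \<union> B) = min (Min A) (Min B)" "Max (A \<union> B) = max (Max A) (Max B)"
    using assms by (simp_all add: Min_Un Max_Un)
  ultimately show "Min (A \<union> B) + Max (A \<union> B) < Min A + Max A"
    and "Min B + Max B < Min (A \<union> B) + Max (A \<union> B)" by linarith+
qed

lemma flip_step_top_part:
  assumes "flip_step H S S'" "connected_in H e"
  shows "top_part S' e = top_part S e \<or>
    Min (top_part S' e) + Max (top_part S' e) < Min (top_part S e) + Max (top_part S e)"
proof -
  obtain U V where UV: "set_less V U" "contracts U V S S' \<or> contracts V U S' S"
    and S: "construct H S" "construct H S'" using assms(1) unfolding flip_step_def by blast
  have "U \<union> V \<subseteq> \<Union>H"
    using UV(2) contracts_labels verts_construct[OF S(1)] verts_construct[OF S(2)] by blast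
  then have fin: "finite U" "finite V"
    using hypergraph_finite[OF construct_hypergraph[OF S(1)]] by auto
  have less: "v < u" if "u \<in> U" "v \<in> V" for u v
    using UV(1) Max_ge[OF fin(2) that(2)] Min_le[OF fin(1) that(1)] unfolding set_less_def by linarith
  have merge:
    "Min (U \<inter> e \<union> V \<inter> e) + Max (U \<inter> e \<union> V \<inter> e) < Min (U \<inter> e) + Max (U \<inter> e)"
    "Min (V \<inter> e) + Max (V \<inter> e) < Min (U \<inter> e \<union> V \<inter> e) + Max (U \<inter> e \<union> V \<inter> e)"
    if "U \<inter> e \<noteq> {}" "V \<inter> e \<noteq> {}"
    by (rule Min_add_Max_merge; use that fin less in simp)+
  have eq: "(U \<union> V) \<inter> e = U \<inter> e \<union> V \<inter> e" "(V \<union> U) \<inter> e = U \<inter> e \<union> V \<inter> e" by blast+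
  from UV(2) show ?thesis
  proof
    assume "contracts U V S S'"
    from contracts_top_part[OF this S(1) assms(2)]
    consider "top_part S' e = top_part S e"
      | "U \<inter> e \<noteq> {}" "top_part S e = U \<inter> e" "top_part S' e = U \<inter> e \<union> V \<inter> e"
      unfolding eq by blast
    then show ?thesis
    proof cases
      case 2
      show ?thesis unfolding 2 using merge(1)[OF 2(1)] by (cases "V \<inter> e = {}") (simp_all only: Un_empty_right simp_thms)
    qed simp
  next
    assume "contracts V U S' S"
    from contracts_top_part[OF this S(2) assms(2)]
    consider "top_part S' e = top_part S e"
      | "V \<inter> e \<noteq> {}" "top_part S' e = V \<inter> e" "top_part S e = U \<inter> e \<union> V \<inter> e"
      unfolding eq by metis
    then show ?thesis
    proof cases
      case 2
      show ?thesis unfolding 2 using merge(2)[OF _ 2(1)] by (cases "U \<inter> e = {}") (simp_all only: Un_empty_left simp_thms)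
    qed simp
  qed
qed

text \<open>The disjunction composes along a path; a weak inequality of the integers would not,
  since different values can have the same integer.\<close>

lemma flip_le_top_part:
  assumes "flip_le H S S'" "connected_in H e"
  shows "top_part S' e = top_part S e \<or>
    Min (top_part S' e) + Max (top_part S' e) < Min (top_part S e) + Max (top_part S e)"
  using assms(1) unfolding flip_le_def
proof (induction rule: rtranclp_induct)
  case (step T T')
  have trans: "A'' = A \<or> f A'' < f A" if "A'' = A' \<or> f A'' < f A'" "A' = A \<or> f A' < f A"
    for A A' A'' and f :: "int set \<Rightarrow> int" using that by auto
  show ?case
    by (rule trans[where f = "\<lambda>A. Min A + Max A", OF flip_step_top_part[OF step.hyps(2) assms(2)] step.IH])
qed simp

text \<open>A change between \<open>S\<close> and \<open>U\<close> would lower the integer strictly,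
  and the steps from \<open>U\<close> to \<open>T\<close> cannot raise it again.\<close>

lemma flip_interval_top_part:
  assumes "flip_le H S U" "flip_le H U T" "connected_in H e" "top_part S e = top_part T e"
  shows "top_part U e = top_part S e"
  using flip_le_top_part[OF assms(1,3)] flip_le_top_part[OF assms(2,3)] assms(4)
  by (metis order.strict_trans order.irrefl)

text \<open>The statements about \<open>\<le>\<close> that involve the largest element are the mirror images of those
  about the smallest one. The parameter \<open>d\<close> selects the direction, so that both are proved once.\<close>

definition before :: "bool \<Rightarrow> int set \<Rightarrow> int set \<Rightarrow> bool" where
  "before d A C \<longleftrightarrow> (\<forall>x\<in>A. \<forall>y\<in>C. if d then x < y else y < x)"

definition directed_step :: "bool \<Rightarrow> hypergraph \<Rightarrow> ctree \<Rightarrow> ctree \<Rightarrow> bool" where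
  "directed_step d H S S' = (if d then flip_step H S S' else flip_step H S' S)"

definition directed_le :: "bool \<Rightarrow> hypergraph \<Rightarrow> ctree \<Rightarrow> ctree \<Rightarrow> bool" where
  "directed_le d H = (directed_step d H)\<^sup>*\<^sup>*"

lemma directed_le_True: "directed_le True H S S' = flip_le H S S'"
proof -
  have "directed_step True H = flip_step H" by (intro ext) (simp add: directed_step_def)
  then show ?thesis by (simp add: directed_le_def flip_le_def)
qed

lemma directed_le_False: "directed_le False H S S' = flip_le H S' S"
proof -
  have "directed_step False H = (flip_step H)\<inverse>\<inverse>" by (intro ext) (simp add: directed_step_def)
  then show ?thesis by (simp add: directed_le_def flip_le_def rtranclp_conversep)
qed

text \<open>The elementwise form is inherited by all subsets, empty ones included, whereas
  \<open>set_less\<close> depends on extremal elements.\<close>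

lemma before_subset: "before d A C \<Longrightarrow> A' \<subseteq> A \<Longrightarrow> C' \<subseteq> C \<Longrightarrow> before d A' C'"
  unfolding before_def by blast

lemma before_set_less:
  assumes "before d A C" "finite A" "finite C" "A \<noteq> {}" "C \<noteq> {}"
  shows "if d then set_less A C else set_less C A"
  using assms unfolding before_def set_less_def by (cases d) auto

lemma set_less_before:
  assumes "set_less A C" "finite A" "finite C"
  shows "before True A C" "before False C A"
proof -
  have "x < y" if "x \<in> A" "y \<in> C" for x y
    using assms(1) Max_ge[OF assms(2) that(1)] Min_le[OF assms(3) that(2)] unfolding set_less_def by linarith
  then show "before True A C" "before False C A" by (auto simp: before_def)
qed

lemma
  assumes S: "construct H S" "construct H S'" and PQ: "P \<noteq> {}" "Q \<noteq> {}"
  shows directed_step_contract: "contracts P Q S S' \<Longrightarrow> before d Q P \<Longrightarrow> directed_step d H S S'"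
    and directed_step_split: "contracts P Q S' S \<Longrightarrow> before d P Q \<Longrightarrow> directed_step d H S S'"
proof -
  have fin: "finite P" "finite Q" if "contracts P Q A A'" "construct H A" for A A'
  proof -
    have "P \<union> Q \<subseteq> \<Union>H" using contracts_labels[OF that(1)] verts_construct[OF that(2)] by simp
    then show "finite P" "finite Q" using hypergraph_finite[OF construct_hypergraph[OF S(1)]] by auto
  qed
  show "directed_step d H S S'" if "contracts P Q S S'" "before d Q P"
    using before_set_less[OF that(2) fin(2,1)[OF that(1) S(1)] PQ(2,1)] that(1) S
    unfolding directed_step_def flip_step_def by (cases d) auto
  show "directed_step d H S S'" if "contracts P Q S' S" "before d P Q"
    using before_set_less[OF that(2) fin[OF that(1) S(2)] PQ] that(1) S
    unfolding directed_step_def flip_step_def by (cases d) auto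
qed

lemma directed_step_construct: "directed_step d H S S' \<Longrightarrow> construct H S \<and> construct H S'"
  unfolding directed_step_def flip_step_def by (cases d) auto

lemma directed_le_construct: "directed_le d H S S' \<Longrightarrow> construct H S \<Longrightarrow> construct H S'"
  unfolding directed_le_def by (induction rule: rtranclp_induct) (auto dest: directed_step_construct)

section \<open>Lifting paths from the subtrees to the whole tree\<close>

lemma contracts_plant:
  assumes H: "hypergraph H" and Z: "Z \<in> comps H Y" and T: "\<And>Z. Z \<in> comps H Y \<Longrightarrow> construct (induce H Z) (T Z)"
    and A: "construct (induce H Z) A" and c: "contracts P Q A A'"
  shows "contracts P Q (plant Y (comps H Y) (T(Z := A))) (plant Y (comps H Y) (T(Z := A')))"
proof -
  let ?I = "comps H Y"
  let ?cs = "Abs_fset ((T(Z := A)) ` ?I)"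
  have fin: "finite ?I" by (rule finite_comps[OF H])
  \<comment> \<open>Children form a set, so removing \<open>A\<close> must not remove a subtree
    elsewhere; vertex sets tell the subtrees apart.\<close>
  have A_notin: "A \<noteq> T Z'" if "Z' \<in> ?I" "Z' \<noteq> Z" for Z'
    using verts_comp[OF H that(1) T[OF that(1)]] verts_comp[OF H Z A] that(2) by auto
  have cs: "fset ?cs = (T(Z := A)) ` ?I" using fin by (simp add: Abs_fset_inverse)
  have "fset (finsert A' (?cs |-| {|A|})) = insert A' (fset ?cs - {A})" by simp
  also have "\<dots> = (T(Z := A')) ` ?I"
    unfolding cs using Z A_notin by (auto simp: image_iff)
  finally have "fset (finsert A' (?cs |-| {|A|})) = (T(Z := A')) ` ?I" .
  then have eq: "finsert A' (?cs |-| {|A|}) = Abs_fset ((T(Z := A')) ` ?I)" by (metis fset_inverse)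
  have "A |\<in>| ?cs" unfolding cs using Z by auto
  from contracts.below[OF this c, of Y] show ?thesis by (simp only: plant_def eq)
qed

lemma directed_le_plant_update:
  assumes H: "hypergraph H" "hg_connected H" and Y: "Y \<noteq> {}" "Y \<subseteq> \<Union>H" and Z: "Z \<in> comps H Y"
    and T: "\<And>Z. Z \<in> comps H Y \<Longrightarrow> construct (induce H Z) (T Z)"
    and A: "directed_le d (induce H Z) A A'"
  shows "directed_le d H (plant Y (comps H Y) (T(Z := A))) (plant Y (comps H Y) (T(Z := A')))"
  using A unfolding directed_le_def
proof (induction rule: rtranclp_induct)
  case (step B C)
  have BC: "construct (induce H Z) B" "construct (induce H Z) C"
    using directed_step_construct[OF step.hyps(2)] by blast+
  have c: "construct H (plant Y (comps H Y) (T(Z := D)))" if "construct (induce H Z) D" for D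
    by (rule construct_plantI[OF H Y]) (use T that in auto)
  have "directed_step d H (plant Y (comps H Y) (T(Z := B))) (plant Y (comps H Y) (T(Z := C)))"
    using step.hyps(2) c[OF BC(1)] c[OF BC(2)] contracts_plant[OF H(1) Z T BC(1)] contracts_plant[OF H(1) Z T BC(2)]
    unfolding directed_step_def flip_step_def by (cases d) (simp; blast)+
  then show ?case by (rule rtranclp.rtrancl_into_rtrancl[OF step.IH])
qed simp

text \<open>The subtrees are replaced one at a time; \<open>F\<close> is the set of components
  already treated.\<close>

lemma directed_le_plant:
  assumes H: "hypergraph H" "hg_connected H" and Y: "Y \<noteq> {}" "Y \<subseteq> \<Union>H"
    and T: "\<And>Z. Z \<in> comps H Y \<Longrightarrow> construct (induce H Z) (T Z)"
    and T': "\<And>Z. Z \<in> comps H Y \<Longrightarrow> directed_le d (induce H Z) (T Z) (T' Z)"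
  shows "directed_le d H (plant Y (comps H Y) T) (plant Y (comps H Y) T')"
proof -
  have "directed_le d H (plant Y (comps H Y) T) (plant Y (comps H Y) (\<lambda>Z. if Z \<in> F then T' Z else T Z))"
    if "F \<subseteq> comps H Y" for F
    using finite_subset[OF that finite_comps[OF H(1)]] that
  proof (induction F rule: finite_induct)
    case (insert Z F)
    let ?R = "\<lambda>Z. if Z \<in> F then T' Z else T Z"
    have Z: "Z \<in> comps H Y" using insert by blast
    have "construct (induce H Z') (?R Z')" if "Z' \<in> comps H Y" for Z'
      using T[OF that] directed_le_construct[OF T'[OF that]] by auto
    from directed_le_plant_update[OF H Y Z this T'[OF Z]]
    have "directed_le d H (plant Y (comps H Y) (?R(Z := T Z))) (plant Y (comps H Y) (?R(Z := T' Z)))" .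
    moreover have "?R(Z := T Z) = ?R" "?R(Z := T' Z) = (\<lambda>Z'. if Z' \<in> insert Z F then T' Z' else T Z')"
      using insert(2) by auto
    ultimately show ?case using insert unfolding directed_le_def by (auto elim: rtranclp_trans)
  qed (simp add: directed_le_def)
  from this[OF subset_refl]
  have "directed_le d H (plant Y (comps H Y) T) (plant Y (comps H Y) (\<lambda>Z. if Z \<in> comps H Y then T' Z else T Z))" .
  moreover have "plant Y (comps H Y) (\<lambda>Z. if Z \<in> comps H Y then T' Z else T Z) = plant Y (comps H Y) T'"
    by (intro plant_cong) auto
  ultimately show ?thesis by simp
qed

section \<open>Pulling a label to the root\<close>

text \<open>The pairwise content of \<open>hereditarily_ordered\<close>, without the list of
  components and in the elementwise form of \<open>before\<close>.\<close>

definition comps_ordered :: "hypergraph \<Rightarrow> bool" where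
  "comps_ordered H \<longleftrightarrow> (\<forall>X Z Z'. X \<noteq> {} \<and> X \<subseteq> \<Union>H \<and> Z \<in> comps H X \<and> Z' \<in> comps H X \<and> Z \<noteq> Z' \<longrightarrow>
     before True Z Z' \<or> before True Z' Z)"

lemma comps_orderedD:
  assumes "comps_ordered H" "X \<noteq> {}" "X \<subseteq> \<Union>H" "Z \<in> comps H X" "Z' \<in> comps H X" "Z \<noteq> Z'"
  shows "before d Z Z' \<or> before d Z' Z"
proof -
  have "before False A C = before True C A" for A C by (auto simp: before_def)
  then show ?thesis using assms unfolding comps_ordered_def by (cases d) metis+
qed

lemma hereditarily_ordered_comps:
  assumes H: "hypergraph H" and "hereditarily_ordered H"
  shows "comps_ordered H"
  unfolding comps_ordered_def
proof (intro allI impI; elim conjE)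
  fix X Z Z' assume X: "X \<noteq> {}" "X \<subseteq> \<Union>H" and Z: "Z \<in> comps H X" "Z' \<in> comps H X" "Z \<noteq> Z'"
  obtain Zs where Zs: "set Zs = comps H X" "sorted_wrt set_less Zs"
    using assms(2) X unfolding hereditarily_ordered_def by blast
  obtain i j where ij: "i < length Zs" "j < length Zs" "Z = Zs ! i" "Z' = Zs ! j"
    using Z(1,2) Zs(1) by (metis in_set_conv_nth)
  then have "i < j \<or> j < i" using Z(3) by (metis linorder_neqE_nat)
  then have "set_less Z Z' \<or> set_less Z' Z" using ij Zs(2) by (auto simp: sorted_wrt_iff_nth_less)
  then show "before True Z Z' \<or> before True Z' Z"
    using set_less_before(1) hypergraph_finite[OF H comps_subset[OF H]] Z(1,2) by meson
qed

text \<open>Components of \<open>induce H C\<close> minus \<open>X\<close> are components of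
  \<open>H\<close> minus \<open>W \<union> X\<close>, by \<open>comps_Un\<close>, and so are already
  comparable.\<close>

lemma comps_ordered_induce:
  assumes H: "hypergraph H" "comps_ordered H" and W: "W \<noteq> {}" "W \<subseteq> \<Union>H" and C: "C \<in> comps H W"
  shows "comps_ordered (induce H C)"
  unfolding comps_ordered_def
proof (intro allI impI; elim conjE)
  fix X Z Z' assume X: "X \<noteq> {}" "X \<subseteq> \<Union>(induce H C)"
    and Z: "Z \<in> comps (induce H C) X" "Z' \<in> comps (induce H C) X" "Z \<noteq> Z'"
  have XC: "X \<subseteq> C" using X(2) Union_comp[OF H(1) C] by simp
  have "Z \<in> comps H (W \<union> X)" "Z' \<in> comps H (W \<union> X)" using comps_Un[OF H(1) C XC] Z by auto
  moreover have "W \<union> X \<noteq> {}" "W \<union> X \<subseteq> \<Union>H" using W XC comps_subset[OF H(1) C] by auto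
  ultimately show "before True Z Z' \<or> before True Z' Z"
    using comps_orderedD[OF H(2), of "W \<union> X" Z Z' True] Z(3) by blast
qed

lemma before_extremal:
  assumes "finite F" "F \<noteq> {}" "\<And>Z. Z \<in> F \<Longrightarrow> Z \<noteq> {}"
    and "\<And>Z Z'. Z \<in> F \<Longrightarrow> Z' \<in> F \<Longrightarrow> Z \<noteq> Z' \<Longrightarrow> before d Z Z' \<or> before d Z' Z"
  shows "\<exists>Z\<in>F. \<forall>Z'\<in>F. Z' \<noteq> Z \<longrightarrow> before d Z' Z"
  using assms
proof (induction F rule: finite_ne_induct)
  case (insert C F)
  obtain Z where Z: "Z \<in> F" "\<forall>Z'\<in>F. Z' \<noteq> Z \<longrightarrow> before d Z' Z" using insert by blast
  \<comment> \<open>\<open>before\<close> is not transitive through the empty set; \<open>z\<close>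
    is the intermediate point for the comparison via \<open>Z\<close>.\<close>
  then obtain z where z: "z \<in> Z" using insert.prems(1)[of Z] by blast
  have "C \<noteq> Z" using Z insert by blast
  then have "before d Z C \<or> before d C Z" using insert.prems(2)[of Z C] Z by blast
  then show ?case
  proof
    assume ZC: "before d Z C"
    have "before d Z' C" if "Z' \<in> F" for Z'
    proof (cases "Z' = Z")
      case False
      then have "before d Z' Z" using Z that by blast
      then have "if d then x < y else y < x" if "x \<in> Z'" "y \<in> C" for x y
        using ZC that z unfolding before_def by (cases d) (auto intro: order.strict_trans)
      then show ?thesis unfolding before_def by blast
    qed (use ZC in simp)
    then show ?thesis by blast
  next
    assume "before d C Z"
    then show ?thesis using Z by blast
  qed
qed simp

text \<open>A single family \<open>T\<close> over the components of \<open>H\<close> minus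
  \<open>W \<union> Q\<close> supplies the lower subtrees of both trees, so the lemma serves for
  contracting an edge at the root and for splitting the root.\<close>

lemma contracts_root:
  assumes H: "hypergraph H" "hg_connected H" and W: "W \<noteq> {}" "W \<subseteq> \<Union>H" and Z: "Z \<in> comps H W"
    and Q: "Q \<noteq> {}" "Q \<subseteq> Z"
    and T: "\<And>C. C \<in> comps H (W \<union> Q) \<Longrightarrow> construct (induce H C) (T C)"
  defines "S \<equiv> plant W (comps H W) (T(Z := plant Q (comps (induce H Z) Q) T))"
    and "S' \<equiv> plant (W \<union> Q) (comps H (W \<union> Q)) T"
  shows "\<And>C. C \<in> comps H W \<Longrightarrow> construct (induce H C) ((T(Z := plant Q (comps (induce H Z) Q) T)) C)"
    and "construct H S" "construct H S'" "contracts W Q S S'"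
proof -
  note split = comps_Un[OF H(1) Z Q(2)]
  let ?I = "comps H W" and ?J = "comps (induce H Z) Q"
  let ?q = "plant Q ?J T"
  have "construct (induce (induce H Z) C) (T C)" if "C \<in> ?J" for C
  proof -
    have "C \<subseteq> Z" using comps_subset[OF hypergraph_comp[OF H(1) Z] that] Union_comp[OF H(1) Z] by simp
    then have "induce (induce H Z) C = induce H C" unfolding induce_def by auto
    then show ?thesis using T that split by simp
  qed
  then have q: "construct (induce H Z) ?q"
    using construct_plantI[OF hypergraph_comp[OF H(1) Z] hg_connected_comp[OF H(1) Z] Q(1)]
      Union_comp[OF H(1) Z] Q(2) by simp
  show child: "construct (induce H C) ((T(Z := ?q)) C)" if "C \<in> ?I" for C
    using T[of C] split q that by auto
  show "construct H S" unfolding S_def by (rule construct_plantI[OF H W child])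
  have "W \<union> Q \<subseteq> \<Union>H" using W Q comps_subset[OF H(1) Z] by blast
  then show "construct H S'" unfolding S'_def using W T by (intro construct_plantI[OF H]) auto
  have q_notin: "T C \<noteq> ?q" if "C \<in> ?I - {Z}" for C
  proof -
    have C: "C \<in> ?I" "C \<noteq> Z" using that by blast+
    show ?thesis using verts_comp[OF H(1) C(1) child[OF C(1)]] verts_comp[OF H(1) Z q] C(2) by auto
  qed
  have fin: "finite ?I" "finite ?J" "finite (comps H (W \<union> Q))"
    using finite_comps[OF H(1)] finite_comps[OF hypergraph_comp[OF H(1) Z]] by blast+
  let ?cs = "Abs_fset ((T(Z := ?q)) ` ?I)" and ?ds = "Abs_fset (T ` ?J)"
  have cs: "fset ?cs = (T(Z := ?q)) ` ?I" and ds: "fset ?ds = T ` ?J"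
    using fin by (simp_all add: Abs_fset_inverse)
  have q_Node: "?q = Node Q ?ds" by (simp add: plant_def)
  have "fset ((?cs |-| {|?q|}) |\<union>| ?ds) = (fset ?cs - {?q}) \<union> fset ?ds" by simp
  also have "fset ?cs - {?q} = T ` (?I - {Z})"
    unfolding cs using q_notin Z by (auto simp: image_iff)
  also have "T ` (?I - {Z}) \<union> fset ?ds = T ` comps H (W \<union> Q)"
    unfolding split ds by (simp add: image_Un)
  finally have "(?cs |-| {|?q|}) |\<union>| ?ds = Abs_fset (T ` comps H (W \<union> Q))" by (metis fset_inverse)
  moreover have "?q |\<in>| ?cs" unfolding cs using Z by auto
  ultimately show "contracts W Q S S'"
    using contracts.here[of Q ?ds ?cs W] unfolding S_def S'_def plant_def[of W] plant_def[of "W \<union> Q"] q_Node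
    by simp
qed

lemma directed_le_trans: "directed_le d H A B \<Longrightarrow> directed_le d H B C \<Longrightarrow> directed_le d H A C"
  unfolding directed_le_def by (rule rtranclp_trans)

text \<open>The part \<open>X\<close> of the root is pushed below \<open>Y\<close> one component of \<open>H\<close> minus \<open>Y\<close> at a time,
  starting with the most distant one.\<close>

lemma directed_le_pull_root:
  assumes H: "hypergraph H" "hg_connected H" "comps_ordered H" and Y: "Y \<noteq> {}" "Y \<subseteq> \<Union>H"
    and "X \<subseteq> \<Union>H" "before d Y X"
    and "\<And>C. C \<in> comps H (Y \<union> X) \<Longrightarrow> construct (induce H C) (T C)"
  shows "\<exists>V. directed_le d H (plant (Y \<union> X) (comps H (Y \<union> X)) T) V \<and> construct H V \<and> root_label V = Y \<and>
    (\<forall>e. connected_in H e \<and> e \<inter> Y = {} \<longrightarrow> top_part V e = top_part (plant (Y \<union> X) (comps H (Y \<union> X)) T) e)"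
  using assms(6-8)
proof (induction "card X" arbitrary: X T rule: less_induct)
  case less
  let ?U = "plant (Y \<union> X) (comps H (Y \<union> X)) T"
  show ?case
  proof (cases "X = {}")
    case True
    have "construct H ?U" by (rule construct_plantI[OF H(1,2)]) (use Y less.prems in auto)
    then show ?thesis using True by (intro exI[of _ ?U]) (simp add: directed_le_def)
  next
    case False
    have disj: "Y \<inter> X = {}" using less.prems(2) unfolding before_def by (auto split: if_splits)
    \<comment> \<open>The components among which \<open>X\<close> is distributed; one of them is
      emptied of \<open>X\<close> in each round.\<close>
    let ?F = "{Z \<in> comps H Y. Z \<inter> X \<noteq> {}}"
    have F_cover: "\<exists>Z\<in>?F. x \<in> Z" if "x \<in> X" for x
    proof -
      have "x \<in> \<Union>(comps H Y)" using Union_comps[OF H(1), of Y] disj that less.prems(1) by blast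
      then show ?thesis using that by blast
    qed
    have "\<exists>Z\<in>?F. \<forall>Z'\<in>?F. Z' \<noteq> Z \<longrightarrow> before d Z' Z"
    proof (rule before_extremal)
      show "finite ?F" using finite_comps[OF H(1)] by simp
      show "?F \<noteq> {}" using F_cover False by blast
      show "Z \<noteq> {}" if "Z \<in> ?F" for Z using that by blast
      show "before d Z Z' \<or> before d Z' Z" if "Z \<in> ?F" "Z' \<in> ?F" "Z \<noteq> Z'" for Z Z'
        using comps_orderedD[OF H(3) Y, of Z Z'] that by blast
    qed
    then obtain Z where Z: "Z \<in> comps H Y" "Z \<inter> X \<noteq> {}" and ext: "\<forall>Z'\<in>?F. Z' \<noteq> Z \<longrightarrow> before d Z' Z"
      by blast
    \<comment> \<open>\<open>Q\<close> is split off from the root now, \<open>W\<close> is what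
      stays, and \<open>X'\<close> is left for the induction.\<close>
    define Q where "Q = X \<inter> Z"
    define X' where "X' = X - Z"
    define W where "W = Y \<union> X'"
    have Q: "Q \<noteq> {}" "Q \<subseteq> Z" using Z(2) by (auto simp: Q_def)
    have ZW: "Z \<inter> W = {}" using comps_disjoint_deleted[OF H(1) Z(1)] by (auto simp: W_def X'_def)
    have ZcW: "Z \<in> comps H W" by (rule comps_mono_deleted[OF H(1) Z(1) _ ZW]) (simp add: W_def)
    have W: "W \<noteq> {}" "W \<subseteq> \<Union>H" using Y less.prems(1) by (auto simp: W_def X'_def)
    have WQ: "Y \<union> X = W \<union> Q" by (auto simp: W_def X'_def Q_def)
    \<comment> \<open>The rest of \<open>X\<close> lies in components that come before
      \<open>Z\<close>. Together with \<open>Y\<close> before \<open>X\<close> this makes splitting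
      \<open>Q\<close> off below \<open>W\<close> a step in direction \<open>d\<close>.\<close>
    have "before d X' Q"
      unfolding before_def
    proof (intro ballI)
      fix x y assume x: "x \<in> X'" and y: "y \<in> Q"
      then obtain Z' where "Z' \<in> ?F" "x \<in> Z'" using F_cover unfolding X'_def by blast
      moreover have "Z' \<noteq> Z" using calculation x unfolding X'_def by blast
      ultimately show "if d then x < y else y < x"
        using ext y unfolding before_def Q_def by blast
    qed
    moreover have "before d Y Q" using less.prems(2) by (rule before_subset) (auto simp: Q_def)
    ultimately have bef: "before d W Q" unfolding W_def before_def by blast
    let ?T = "T(Z := plant Q (comps (induce H Z) Q) T)"
    let ?S = "plant W (comps H W) ?T"
    have T: "construct (induce H C) (T C)" if "C \<in> comps H (W \<union> Q)" for C
      using less.prems(3) that unfolding WQ by blast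
    note root = contracts_root[OF H(1,2) W ZcW Q T]
    have step: "directed_step d H ?U ?S"
      unfolding WQ by (rule directed_step_split[OF root(3,2) W(1) Q(1) root(4) bef])
    have top: "top_part ?U e = top_part ?S e" if e: "connected_in H e" "e \<inter> Y = {}" for e
    proof -
      \<comment> \<open>The split could affect only sets met by both \<open>W\<close> and
        \<open>Q\<close>. A connected \<open>e\<close> avoiding \<open>Y\<close> that meets
        \<open>W\<close> is not inside \<open>Z\<close>, so it misses \<open>Z\<close> and with it
        \<open>Q\<close>.\<close>
      have "(W \<union> Q) \<inter> e = W \<inter> e" if "W \<inter> e \<noteq> {}"
      proof -
        have "\<not> e \<subseteq> Z" using that ZW by blast
        then have "e \<inter> Z = {}" using connected_subset_comp[OF H(1) Z(1) e] by blast
        then show ?thesis using Q(2) by blast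
      qed
      then show ?thesis using contracts_top_part[OF root(4,2) e(1)] unfolding WQ by metis
    qed
    have "finite X" using hypergraph_finite[OF H(1) less.prems(1)] .
    then have "card X' < card X" unfolding X'_def using Z(2) by (intro psubset_card_mono) auto
    moreover have "X' \<subseteq> \<Union>H" "before d Y X'"
      using less.prems(1) before_subset[OF less.prems(2)] by (auto simp: X'_def)
    ultimately obtain V where V: "directed_le d H ?S V" "construct H V" "root_label V = Y"
      "\<And>e. connected_in H e \<and> e \<inter> Y = {} \<Longrightarrow> top_part V e = top_part ?S e"
      using less.hyps[of X' ?T] root(1) unfolding W_def by blast
    have "directed_le d H ?U V"
      using step V(1) unfolding directed_le_def by (rule converse_rtranclp_into_rtranclp)
    then show ?thesis using V top by auto
  qed
qed

text \<open>If the root meets \<open>K\<close>, the rest of the root is pushed down by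
  \<open>directed_le_pull_root\<close>. Otherwise \<open>K\<close> lies in one component: the label
  is pulled to the root of that subtree, contracted into the root \<open>X\<close>, and then
  \<open>X\<close> is pushed below it. Both kinds of step go in direction \<open>d\<close> because
  \<open>K\<close> comes before everything else.\<close>

lemma directed_le_pull:
  assumes "construct H U" "comps_ordered H" "connected_in H K" "before d K (\<Union>H - K)"
  shows "\<exists>V. directed_le d H U V \<and> construct H V \<and> root_label V = top_part U K \<and>
    (\<forall>e. connected_in H e \<and> e \<inter> top_part U K = {} \<longrightarrow> top_part V e = top_part U e)"
  using assms
proof (induction rule: construct_induct)
  case (plant H X T)
  note H = plant(1,2) and X = plant(3,4) and T = plant(5) and ord = plant.prems(1)
    and K = plant.prems(2) and first = plant.prems(3)
  let ?U = "plant X (comps H X) T"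
  have fin: "finite (comps H X)" by (rule finite_comps[OF H(1)])
  have KH: "K \<subseteq> \<Union>H" using connected_in_subset[OF K] .
  show ?case
  proof (cases "X \<inter> K = {}")
    case False
    define Y where "Y = X \<inter> K"
    have Y: "Y \<noteq> {}" "Y \<subseteq> \<Union>H" using False X by (auto simp: Y_def)
    have top: "top_part ?U K = Y" using False by (simp add: top_part_plant[OF fin] Y_def)
    have XY: "X = Y \<union> (X - K)" by (auto simp: Y_def)
    have "before d Y (X - K)" using first by (rule before_subset) (use X in \<open>auto simp: Y_def\<close>)
    moreover have "X - K \<subseteq> \<Union>H" using X by blast
    ultimately show ?thesis
      using directed_le_pull_root[OF H ord Y, of "X - K" d T] T unfolding top XY[symmetric] by blast
  next
    case True
    obtain Z where Z: "Z \<in> comps H X" "K \<subseteq> Z" using comp_containing[OF H(1) K, of X] True by blast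
    have top: "top_part ?U K = top_part (T Z) K" by (rule top_part_comp[OF H(1) Z T])
    define Y where "Y = top_part (T Z) K"
    have vZ: "verts (T Z) = Z" using verts_comp[OF H(1) Z(1) T[OF Z(1)]] .
    have YK: "Y \<subseteq> K" using top_part_subset[of "T Z" K] by (auto simp: Y_def)
    have Y: "Y \<noteq> {}" "Y \<subseteq> Z"
      using top_part_nonempty[of K "T Z"] connected_in_nonempty[OF H(1) K] vZ Z(2) YK by (auto simp: Y_def)
    have ZH: "Z \<subseteq> \<Union>H" using comps_subset[OF H(1) Z(1)] .
    have "comps_ordered (induce H Z)" by (rule comps_ordered_induce[OF H(1) ord X Z(1)])
    moreover have "connected_in (induce H Z) K" using connected_in_induce[OF H(1) ZH] K Z(2) by blast
    moreover have "before d K (\<Union>(induce H Z) - K)"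
      using first by (rule before_subset) (use ZH Union_comp[OF H(1) Z(1)] in auto)
    ultimately have "\<exists>V. directed_le d (induce H Z) (T Z) V \<and> construct (induce H Z) V \<and> root_label V = Y \<and>
        (\<forall>e. connected_in (induce H Z) e \<and> e \<inter> Y = {} \<longrightarrow> top_part V e = top_part (T Z) e)"
      unfolding Y_def by (rule plant(6)[OF Z(1)])
    then obtain V0 where V0: "directed_le d (induce H Z) (T Z) V0" "construct (induce H Z) V0"
      "root_label V0 = Y"
      "\<And>e. connected_in (induce H Z) e \<Longrightarrow> e \<inter> Y = {} \<Longrightarrow> top_part V0 e = top_part (T Z) e"
      by metis
    have "\<exists>R. V0 = plant Y (comps (induce H Z) Y) R \<and>
        (\<forall>C\<in>comps (induce H Z) Y. construct (induce (induce H Z) C) (R C))"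
      using V0(2)
    proof (cases rule: construct_cases)
      case (plant Y' R)
      then have "Y' = Y" using V0(3) by simp
      then show ?thesis using plant by blast
    qed
    then obtain R where R: "V0 = plant Y (comps (induce H Z) Y) R"
      "\<And>C. C \<in> comps (induce H Z) Y \<Longrightarrow> construct (induce (induce H Z) C) (R C)" by blast
    \<comment> \<open>The subtrees below the merged node: those of \<open>U\<close> off
      \<open>Z\<close>, and those of \<open>V0\<close> inside \<open>Z\<close>. No set belongs to
      both kinds, so the case distinction is sound.\<close>
    define T' where "T' C = (if C \<in> comps H X - {Z} then T C else R C)" for C
    note split = comps_Un[OF H(1) Z(1) Y(2)]
    have sub: "C \<subseteq> Z" "induce (induce H Z) C = induce H C" "C \<notin> comps H X - {Z}"
      if C: "C \<in> comps (induce H Z) Y" for C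
    proof -
      show 1: "C \<subseteq> Z" using comps_subset[OF hypergraph_comp[OF H(1) Z(1)] C] Union_comp[OF H(1) Z(1)] by simp
      then show "induce (induce H Z) C = induce H C" unfolding induce_def by auto
      show "C \<notin> comps H X - {Z}"
        using 1 comps_eqI[OF H(1) _ Z(1), of C] comps_nonempty[OF hypergraph_comp[OF H(1) Z(1)] C] by blast
    qed
    have T': "construct (induce H C) (T' C)" if "C \<in> comps H (X \<union> Y)" for C
    proof (cases "C \<in> comps H X - {Z}")
      case True
      then show ?thesis using T by (simp add: T'_def)
    next
      case False
      then have "C \<in> comps (induce H Z) Y" using that split by blast
      then have "construct (induce H C) (R C)" using R(2) sub(2) by metis
      moreover have "T' C = R C" unfolding T'_def by (rule if_not_P[OF False])
      ultimately show ?thesis by simp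
    qed
    have V0': "plant Y (comps (induce H Z) Y) T' = V0"
      unfolding R(1) by (rule plant_cong) (use sub(3) in \<open>auto simp: T'_def\<close>)
    note root = contracts_root[OF H X Z(1) Y T', unfolded V0']
    have U1: "plant X (comps H X) (T'(Z := V0)) = plant X (comps H X) (T(Z := V0))" (is "_ = ?U1")
      by (rule plant_cong) (auto simp: T'_def)
    have le1: "directed_le d H ?U ?U1"
      using directed_le_plant_update[OF H X Z(1) T V0(1)] by simp
    let ?U2 = "plant (X \<union> Y) (comps H (X \<union> Y)) T'"
    have bef: "before d Y X" using first by (rule before_subset) (use YK True X in auto)
    have le2: "directed_le d H ?U1 ?U2"
      unfolding directed_le_def U1[symmetric]
      by (rule r_into_rtranclp, rule directed_step_contract[OF root(2,3) X(1) Y(1) root(4) bef])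
    have top1: "top_part ?U1 e = top_part ?U e" if e: "connected_in H e" "e \<inter> Y = {}" for e
    proof (cases "X \<inter> e = {}")
      case False
      then show ?thesis by (simp add: top_part_plant[OF fin])
    next
      case True
      then obtain C where C: "C \<in> comps H X" "e \<subseteq> C" using comp_containing[OF H(1) e(1), of X] by blast
      have "construct (induce H C) ((T(Z := V0)) C)" if "C \<in> comps H X" for C
        using T[OF that] V0(2) by simp
      then have "top_part ?U1 e = top_part ((T(Z := V0)) C) e" by (rule top_part_comp[OF H(1) C])
      also have "\<dots> = top_part (T C) e"
        using V0(4)[of e] e C(2) connected_in_induce[OF H(1) ZH] by auto
      finally show ?thesis using top_part_comp[OF H(1) C T] by simp
    qed
    \<comment> \<open>Merging \<open>Y\<close> into \<open>X\<close> adds nothing to the share of a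
      set that avoids \<open>Y\<close>.\<close>
    have top2: "top_part ?U2 e = top_part ?U1 e" if e: "connected_in H e" "e \<inter> Y = {}" for e
    proof -
      have "(X \<union> Y) \<inter> e = X \<inter> e" using e(2) by blast
      then show ?thesis using contracts_top_part[OF root(4,2) e(1)] unfolding U1 by metis
    qed
    have "\<exists>V. directed_le d H (plant (Y \<union> X) (comps H (Y \<union> X)) T') V \<and> construct H V \<and> root_label V = Y \<and>
        (\<forall>e. connected_in H e \<and> e \<inter> Y = {} \<longrightarrow>
          top_part V e = top_part (plant (Y \<union> X) (comps H (Y \<union> X)) T') e)"
      by (rule directed_le_pull_root[OF H ord Y(1) _ X(2) bef])
        (use Y(2) ZH T' in \<open>auto simp: Un_commute\<close>)
    then obtain V where V: "directed_le d H ?U2 V" "construct H V" "root_label V = Y"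
      "\<And>e. connected_in H e \<Longrightarrow> e \<inter> Y = {} \<Longrightarrow> top_part V e = top_part ?U2 e"
      unfolding Un_commute[of Y X] by blast
    have "directed_le d H ?U V" by (rule directed_le_trans[OF le1 directed_le_trans[OF le2 V(1)]])
    moreover have "top_part V e = top_part ?U e" if "connected_in H e" "e \<inter> Y = {}" for e
      using V(4)[OF that] top2[OF that] top1[OF that] by simp
    ultimately show ?thesis unfolding top Y_def[symmetric] using V(2,3) by blast
  qed
qed

section \<open>Induced delegations\<close>

text \<open>Distinct keys make a list sorted by key unique: both sides carry the same sorted
  sequence of minima, hence the same elements.\<close>

lemma map_listed:
  assumes "finite S" "inj_on (\<lambda>x. Min (V (f x))) S"
  shows "map f (listed (\<lambda>x. V (f x)) S) = listed V (f ` S)"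
proof -
  let ?k = "\<lambda>y. Min (V y)"
  let ?xs = "map f (listed (\<lambda>x. V (f x)) S)" and ?ys = "listed V (f ` S)"
  have inj: "inj_on ?k (f ` S)" using assms(2) by (auto simp: inj_on_def)
  have set: "set ?xs = f ` S" "set ?ys = f ` S"
    using assms(1) distinct_listed[OF assms(1)] distinct_listed[of "f ` S" V] by auto
  have dist: "distinct (map ?k ?xs)" "distinct (map ?k ?ys)"
    using assms distinct_listed[OF assms(1)] distinct_listed[of "f ` S" V] inj set
    by (auto simp: distinct_map comp_def inj_on_def)
  have "sorted (map ?k ?xs)" "sorted (map ?k ?ys)"
    by (simp_all add: listed_def comp_def)
  moreover have "set (map ?k ?xs) = set (map ?k ?ys)" using set by (metis set_map)
  ultimately have "map ?k ?xs = map ?k ?ys" using sorted_distinct_set_unique dist by blast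
  moreover have "inj_on ?k (set ?xs \<union> set ?ys)" using inj set by simp
  ultimately show ?thesis by (rule map_inj_on)
qed

lemma roots_singleton [simp]: "roots Cs {a} = root_label (snd (Cs ! a))"
  by (simp add: roots_def)

locale ordered_clan =
  fixes \<UU> :: "hypergraph set" and \<Xi> :: "team set"
  assumes universe: "ordered_universe \<UU>" and clan: "ordered_strict_clan \<UU> \<Xi>"

text \<open>Induced delegations are again instances of this locale, which is what the inductions on
  \<open>weight\<close> use.\<close>

locale clan_delegation = ordered_clan +
  fixes Cs :: "(hypergraph \<times> ctree) list" and H :: hypergraph
  assumes delegation: "is_delegation \<Xi> (Cs, H)"
begin

abbreviation part :: "nat \<Rightarrow> hypergraph" where "part a \<equiv> fst (Cs ! a)"
abbreviation tree :: "nat \<Rightarrow> ctree" where "tree a \<equiv> snd (Cs ! a)"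

lemma team: "(map fst Cs, H) \<in> \<Xi>"
  using delegation by (simp add: is_delegation_def)

lemma construct_tree: "a < length Cs \<Longrightarrow> construct (part a) (tree a)"
  using delegation nth_mem[of a Cs] by (auto simp: is_delegation_def case_prod_beta)

lemma strict_team: "ordered_strict_team \<UU> (map fst Cs, H)"
  using clan team unfolding ordered_strict_clan_def by blast

lemma hypergraph_H: "hypergraph H" and hg_connected_H: "hg_connected H" and comps_ordered_H: "comps_ordered H"
  using strict_team universe hereditarily_ordered_comps
  unfolding ordered_strict_team_def ordered_universe_def by auto

lemma hypergraph_part: "a < length Cs \<Longrightarrow> hypergraph (part a)"
  using construct_hypergraph construct_tree by blast

lemma connected_part: "a < length Cs \<Longrightarrow> connected_in (part a) (\<Union>(part a))"
  using construct_hg_connected construct_tree hg_connected_iff by blast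

lemma connected_in_part:
  assumes a: "a < length Cs" and e: "connected_in (part a) e"
  shows "connected_in H e"
proof -
  have "part a \<in> set (map fst Cs)" using a by simp
  moreover have "e \<noteq> {}" "e \<subseteq> \<Union>(part a)"
    using connected_in_nonempty[OF hypergraph_part[OF a] e] connected_in_subset[OF e] .
  moreover have "\<forall>K\<in>set (map fst Cs). \<forall>Y. Y \<noteq> {} \<and> Y \<subseteq> \<Union>K \<and> connected_in K Y \<longrightarrow> connected_in H Y"
    using strict_team unfolding ordered_strict_team_def prod.case by blast
  ultimately show ?thesis using e by blast
qed

lemma part_disjoint: "a < length Cs \<Longrightarrow> b < length Cs \<Longrightarrow> a \<noteq> b \<Longrightarrow> \<Union>(part a) \<inter> \<Union>(part b) = {}"
  using strict_team unfolding ordered_strict_team_def by auto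

lemma part_cover: "\<Union>H = (\<Union>a<length Cs. \<Union>(part a))"
  using strict_team unfolding ordered_strict_team_def by auto

lemma part_subset: "a < length Cs \<Longrightarrow> \<Union>(part a) \<subseteq> \<Union>H"
  using part_cover by blast

lemma nonempty: "Cs \<noteq> []"
proof
  assume "Cs = []"
  then have "\<Union>H = {}" using part_cover by simp
  then show False using hg_connected_H unfolding hg_connected_def by blast
qed

lemma part_before:
  assumes "a < b" "b < length Cs"
  shows "before True (\<Union>(part a)) (\<Union>(part b))" "before False (\<Union>(part b)) (\<Union>(part a))"
proof -
  have "set_less (\<Union>(part a)) (\<Union>(part b))"
    using strict_team assms unfolding ordered_strict_team_def by (auto simp: sorted_wrt_iff_nth_less)
  moreover have "finite (\<Union>(part a))" "finite (\<Union>(part b))"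
    using hypergraph_part assms unfolding hypergraph_def by auto
  ultimately show "before True (\<Union>(part a)) (\<Union>(part b))" "before False (\<Union>(part b)) (\<Union>(part a))"
    using set_less_before by blast+
qed

lemma root_tree: "a < length Cs \<Longrightarrow> root_label (tree a) \<noteq> {} \<and> root_label (tree a) \<subseteq> \<Union>(part a)"
  by (drule construct_tree) (erule construct_cases, simp)

lemma roots_inter:
  assumes "B \<subseteq> {..<length Cs}" "a < length Cs"
  shows "roots Cs B \<inter> \<Union>(part a) = (if a \<in> B then root_label (tree a) else {})"
proof -
  have "root_label (tree b) \<inter> \<Union>(part a) = (if b = a then root_label (tree a) else {})" if "b \<in> B" for b
  proof -
    have b: "b < length Cs" using that assms(1) by auto
    show ?thesis
    proof (cases "b = a")
      case False
      then show ?thesis using root_tree[OF b] part_disjoint[OF b assms(2)]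
        by (simp only: if_False) (metis inf_mono order_refl subset_empty)
    next
      case True
      then show ?thesis using root_tree[OF b]
        by (simp only: if_True) (metis Int_absorb2)
    qed
  qed
  then have "(\<Union>b\<in>B. root_label (tree b) \<inter> \<Union>(part a)) = (\<Union>b\<in>B. if b = a then root_label (tree a) else {})"
    by (rule SUP_cong[OF refl])
  also have "\<dots> = (if a \<in> B then root_label (tree a) else {})" by auto
  finally show ?thesis unfolding roots_def by (simp only: UN_simps)
qed

text \<open>\<open>B\<close> can be recovered from its root label, so \<open>mu\<close> branches
  over the same \<open>B\<close> as the product, and different \<open>B\<close> give different
  trees.\<close>

lemma meeting_roots: "B \<subseteq> {..<length Cs} \<Longrightarrow> meeting (map fst Cs) (roots Cs B) = B"
proof -
  assume B: "B \<subseteq> {..<length Cs}"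
  have "roots Cs B \<inter> \<Union>(map fst Cs ! b) \<noteq> {} \<longleftrightarrow> b \<in> B" if "b < length Cs" for b
    using roots_inter[OF B that] root_tree[OF that] that by simp
  then have "{b. b < length Cs \<and> roots Cs B \<inter> \<Union>(map fst Cs ! b) \<noteq> {}} = {b. b < length Cs \<and> b \<in> B}"
    by (rule Collect_cong[OF conj_cong[OF refl]])
  then have "meeting (map fst Cs) (roots Cs B) = {b. b < length Cs \<and> b \<in> B}"
    unfolding meeting_def by simp
  then show ?thesis using B by blast
qed

lemma roots_bounds: "B \<noteq> {} \<Longrightarrow> B \<subseteq> {..<length Cs} \<Longrightarrow> roots Cs B \<noteq> {} \<and> roots Cs B \<subseteq> \<Union>H"
proof -
  assume B: "B \<noteq> {}" "B \<subseteq> {..<length Cs}"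
  have r: "root_label (tree b) \<noteq> {}" "root_label (tree b) \<subseteq> \<Union>H" if "b \<in> B" for b
  proof -
    have b: "b < length Cs" using that B(2) by auto
    show "root_label (tree b) \<noteq> {}" using root_tree[OF b] by blast
    show "root_label (tree b) \<subseteq> \<Union>H" using root_tree[OF b] part_subset[OF b] by (metis order_trans)
  qed
  obtain b where "b \<in> B" using B(1) by blast
  then have "roots Cs B \<noteq> {}" using r(1) unfolding roots_def by blast
  moreover have "roots Cs B \<subseteq> \<Union>H" unfolding roots_def by (rule UN_least) (rule r(2))
  ultimately show ?thesis by blast
qed

lemma restricts_to_iff:
  assumes "construct H U"
  shows "restricts_to Cs U \<longleftrightarrow>
    (\<forall>a<length Cs. \<forall>e. connected_in (part a) e \<longrightarrow> top_part U e = top_part (tree a) e)"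
proof -
  have "restricts_to Cs U \<longleftrightarrow> (\<forall>a<length Cs. construct_restrict U (part a) = tree a)"
    unfolding restricts_to_def all_set_conv_all_nth by (simp add: case_prod_beta)
  then show ?thesis
    using construct_restrict_eq_iff[OF assms construct_tree connected_in_part] by simp
qed

section \<open>Participants of an induced delegation, as a set and in their order\<close>

definition induced :: "nat set \<Rightarrow> int set \<Rightarrow> (hypergraph \<times> ctree) set" where
  "induced B Z = {(K, C). \<Union>K \<subseteq> Z \<and>
     ((K, C) \<in> {Cs ! a |a. a \<in> {..<length Cs} - B} \<or>
      (K, C) \<in> {(induce (part b) (verts c), c) |b c. b \<in> B \<and> c |\<in>| children (tree b)})}"

lemma children_tree:
  assumes "a < length Cs"
  obtains T where "fset (children (tree a)) = T ` comps (part a) (root_label (tree a))"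
    "\<And>Y. Y \<in> comps (part a) (root_label (tree a)) \<Longrightarrow> construct (induce (part a) Y) (T Y) \<and> verts (T Y) = Y"
    "\<And>Y e. Y \<in> comps (part a) (root_label (tree a)) \<Longrightarrow> e \<subseteq> Y \<Longrightarrow> top_part (T Y) e = top_part (tree a) e"
proof -
  from construct_tree[OF assms] show ?thesis
  proof (cases rule: construct_cases)
    case (plant X T)
    have r: "root_label (tree a) = X" by (simp add: plant(1))
    show ?thesis
    proof (rule that[of T])
      show "fset (children (tree a)) = T ` comps (part a) (root_label (tree a))"
        unfolding r unfolding plant(1) by (rule children_plant[OF finite_comps[OF plant(2)]])
      show "construct (induce (part a) Y) (T Y) \<and> verts (T Y) = Y" if "Y \<in> comps (part a) (root_label (tree a))" for Y
        using plant(6) verts_comp[OF plant(2)] that unfolding r by blast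
      show "top_part (T Y) e = top_part (tree a) e" if "Y \<in> comps (part a) (root_label (tree a))" "e \<subseteq> Y" for Y e
        using top_part_comp[OF plant(2) _ that(2) plant(6)] that(1) unfolding r by (simp add: plant(1))
    qed
  qed
qed

text \<open>Untouched participants and subtrees of opened ones are treated alike: each lives inside
  one original participant \<open>a\<close> and has the values of \<open>tree a\<close>.\<close>

lemma inducedD:
  assumes B: "B \<subseteq> {..<length Cs}" and KC: "(K, C) \<in> induced B Z"
  shows "\<Union>K \<subseteq> Z \<and> (\<exists>a<length Cs. K = induce (part a) (\<Union>K) \<and> \<Union>K \<subseteq> \<Union>(part a) \<and> construct K C \<and>
    (if a \<in> B then \<Union>K \<in> comps (part a) (root_label (tree a)) else \<Union>K = \<Union>(part a)) \<and>
    (\<forall>e\<subseteq>\<Union>K. top_part C e = top_part (tree a) e))"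
proof -
  have Z: "\<Union>K \<subseteq> Z" using KC by (auto simp: induced_def)
  from KC consider (old) a where "a < length Cs" "a \<notin> B" "(K, C) = Cs ! a"
    | (new) b c where "b \<in> B" "c |\<in>| children (tree b)" "K = induce (part b) (verts c)" "C = c"
    unfolding induced_def by blast
  then show ?thesis
  proof cases
    case old
    then have "K = part a" "C = tree a" by (metis fst_conv snd_conv)+
    then show ?thesis using old construct_tree[OF old(1)] Z by auto
  next
    case new
    have b: "b < length Cs" using B new(1) by auto
    obtain T where T: "fset (children (tree b)) = T ` comps (part b) (root_label (tree b))"
      "\<And>Y. Y \<in> comps (part b) (root_label (tree b)) \<Longrightarrow> construct (induce (part b) Y) (T Y) \<and> verts (T Y) = Y"
      "\<And>Y e. Y \<in> comps (part b) (root_label (tree b)) \<Longrightarrow> e \<subseteq> Y \<Longrightarrow> top_part (T Y) e = top_part (tree b) e"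
      using children_tree[OF b] by metis
    obtain Y where Y: "Y \<in> comps (part b) (root_label (tree b))" "c = T Y" using T(1) new(2) by auto
    have K: "K = induce (part b) Y" "C = T Y" using new Y T(2) by auto
    have U: "\<Union>K = Y" unfolding K by (rule Union_comp[OF hypergraph_part[OF b] Y(1)])
    have "Y \<subseteq> \<Union>(part b)" by (rule comps_subset[OF hypergraph_part[OF b] Y(1)])
    then show ?thesis using Z b new(1) K U T(2,3)[OF Y(1)] Y(1) by metis
  qed
qed

lemma induced_old: "a < length Cs \<Longrightarrow> a \<notin> B \<Longrightarrow> \<Union>(part a) \<subseteq> Z \<Longrightarrow> (part a, tree a) \<in> induced B Z"
proof -
  assume a: "a < length Cs" "a \<notin> B" and sub: "\<Union>(part a) \<subseteq> Z"
  have "(part a, tree a) \<in> {Cs ! a |a. a \<in> {..<length Cs} - B}"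
    unfolding prod.collapse using a by blast
  then show ?thesis unfolding induced_def mem_Collect_eq prod.case using sub by blast
qed

lemma induced_new:
  assumes "B \<subseteq> {..<length Cs}" "b \<in> B" "Y \<in> comps (part b) (root_label (tree b))" "Y \<subseteq> Z"
  shows "\<exists>C. (induce (part b) Y, C) \<in> induced B Z"
proof -
  have b: "b < length Cs" using assms by auto
  obtain T where T: "fset (children (tree b)) = T ` comps (part b) (root_label (tree b))" "verts (T Y) = Y"
    using children_tree[OF b] assms(3) by metis
  have "T Y |\<in>| children (tree b)" using T(1) assms(3) by auto
  moreover have "\<Union>(induce (part b) Y) = Y" by (rule Union_comp[OF hypergraph_part[OF b] assms(3)])
  ultimately have "(induce (part b) (verts (T Y)), T Y) \<in> induced B Z"
    unfolding induced_def using T(2) assms(2,4) by fastforce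
  then show ?thesis using T(2) by auto
qed

lemma finite_induced: "B \<subseteq> {..<length Cs} \<Longrightarrow> finite (induced B Z)"
proof -
  assume "B \<subseteq> {..<length Cs}"
  then have "finite B" using finite_subset by blast
  have "induced B Z \<subseteq> set Cs \<union> (\<Union>b\<in>B. (\<lambda>c. (induce (part b) (verts c), c)) ` fset (children (tree b)))"
    unfolding induced_def by (auto simp: in_set_conv_nth)
  then show ?thesis using \<open>finite B\<close> by (meson List.finite_set finite_UN_I finite_UnI finite_fset finite_imageI finite_subset)
qed

text \<open>Meeting participants come from the same index, so they have the same vertices and, by
  their values, the same tree. In particular their minima are pairwise distinct, which fixes the
  listing.\<close>

lemma induced_eqI:
  assumes B: "B \<subseteq> {..<length Cs}" and x: "(K, C) \<in> induced B Z" "(K', C') \<in> induced B Z"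
    and meet: "\<Union>K \<inter> \<Union>K' \<noteq> {}"
  shows "(K, C) = (K', C')"
proof -
  obtain a where a: "a < length Cs" "K = induce (part a) (\<Union>K)" "\<Union>K \<subseteq> \<Union>(part a)" "construct K C"
    "if a \<in> B then \<Union>K \<in> comps (part a) (root_label (tree a)) else \<Union>K = \<Union>(part a)"
    "\<forall>e\<subseteq>\<Union>K. top_part C e = top_part (tree a) e"
    using inducedD[OF B x(1)] by metis
  obtain a' where a': "a' < length Cs" "K' = induce (part a') (\<Union>K')" "\<Union>K' \<subseteq> \<Union>(part a')" "construct K' C'"
    "if a' \<in> B then \<Union>K' \<in> comps (part a') (root_label (tree a')) else \<Union>K' = \<Union>(part a')"
    "\<forall>e\<subseteq>\<Union>K'. top_part C' e = top_part (tree a') e"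
    using inducedD[OF B x(2)] by metis
  have "a = a'" using part_disjoint[OF a(1) a'(1)] a(3) a'(3) meet by blast
  then have U: "\<Union>K = \<Union>K'"
    using a(5) a'(5) comps_eqI[OF hypergraph_part[OF a(1)] _ _ meet] by (auto split: if_splits)
  then have K: "K = K'" using a(2) a'(2) \<open>a = a'\<close> by metis
  have "C = C'"
    by (rule construct_eqI[OF a(4)])
      (use a'(4,6) a(6) K \<open>a = a'\<close> connected_in_subset in \<open>auto\<close>)
  then show ?thesis using K by simp
qed

lemma set_induced_constructs: "B \<subseteq> {..<length Cs} \<Longrightarrow> set (induced_constructs Cs B Z) = induced B Z"
  using distinct_listed(2)[OF finite_induced, of B "\<lambda>(K, C). \<Union>K" Z]
  unfolding induced_constructs_def induced_def by simp

text \<open>Links the recursion of \<open>mu\<close>, which runs on hypergraphs, with that of the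
  product, which runs on trees. \<open>X\<close> is prescribed only on \<open>B\<close> because
  \<open>mu\<close> supplies intersections with the root of \<open>U\<close>, which equal the root
  labels just there.\<close>

lemma map_fst_induced_constructs:
  assumes B: "B \<subseteq> {..<length Cs}" and X: "\<And>b. b \<in> B \<Longrightarrow> X b = root_label (tree b)"
  shows "map fst (induced_constructs Cs B Z) = induced_parts (map fst Cs) B X Z"
proof -
  have inj: "inj_on (\<lambda>x. Min (\<Union>(fst x))) (induced B Z)"
  proof (rule inj_onI)
    fix x y assume x: "x \<in> induced B Z" and y: "y \<in> induced B Z" and eq: "Min (\<Union>(fst x)) = Min (\<Union>(fst y))"
    have *: "Min (\<Union>(fst z)) \<in> \<Union>(fst z)" if z: "z \<in> induced B Z" for z
    proof -
      have "construct (fst z) (snd z)" using inducedD[OF B, of "fst z" "snd z" Z] z by auto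
      then have "finite (\<Union>(fst z))" "\<Union>(fst z) \<noteq> {}"
        using construct_hypergraph construct_hg_connected unfolding hypergraph_def hg_connected_def by blast+
      then show ?thesis by (rule Min_in)
    qed
    have "\<Union>(fst x) \<inter> \<Union>(fst y) \<noteq> {}" using *[OF x] *[OF y] eq by (metis IntI empty_iff)
    then show "x = y" using induced_eqI[OF B, of "fst x" "snd x" Z "fst y" "snd y"] x y by simp
  qed
  have "{K. \<Union>K \<subseteq> Z \<and> (K \<in> {map fst Cs ! a |a. a \<in> {..<length (map fst Cs)} - B} \<or>
      K \<in> {induce (map fst Cs ! b) Y |b Y. b \<in> B \<and> Y \<in> comps (map fst Cs ! b) (X b)})} = fst ` induced B Z"
    (is "?P = _")
  proof (intro equalityI subsetI)
    fix K assume "K \<in> ?P"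
    then consider (old) a where "a < length Cs" "a \<notin> B" "K = map fst Cs ! a" "\<Union>K \<subseteq> Z"
      | (new) b Y where "b \<in> B" "Y \<in> comps (map fst Cs ! b) (X b)" "K = induce (map fst Cs ! b) Y" "\<Union>K \<subseteq> Z"
      by auto
    then show "K \<in> fst ` induced B Z"
    proof cases
      case old
      then have "(part a, tree a) \<in> induced B Z" "K = part a" using induced_old by auto
      then show ?thesis by force
    next
      case new
      have b: "b < length Cs" using B new(1) by auto
      have Y: "Y \<in> comps (part b) (root_label (tree b))" using new b X by simp
      have "Y \<subseteq> Z" using new(3,4) Union_comp[OF hypergraph_part[OF b] Y] b by simp
      from induced_new[OF B new(1) Y this] show ?thesis using new(3) b by force
    qed
  next
    fix K assume "K \<in> fst ` induced B Z"
    then obtain C where KC: "(K, C) \<in> induced B Z" by auto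
    obtain a where a: "a < length Cs" "K = induce (part a) (\<Union>K)"
      "if a \<in> B then \<Union>K \<in> comps (part a) (root_label (tree a)) else \<Union>K = \<Union>(part a)" "\<Union>K \<subseteq> Z"
      using inducedD[OF B KC] by metis
    show "K \<in> ?P"
    proof (cases "a \<in> B")
      case True
      then have "\<Union>K \<in> comps (map fst Cs ! a) (X a)" "K = induce (map fst Cs ! a) (\<Union>K)"
        using a X by simp_all
      then show ?thesis using True a(4) by blast
    next
      case False
      then have "K = map fst Cs ! a" using a by simp
      then show ?thesis using False a(1,4) by auto
    qed
  qed
  then have "induced_parts (map fst Cs) B X Z = listed Union (fst ` induced B Z)"
    unfolding induced_parts_def by simp
  moreover have "induced_constructs Cs B Z = listed (\<lambda>x. \<Union>(fst x)) (induced B Z)"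
    unfolding induced_constructs_def induced_def by (simp add: case_prod_unfold)
  ultimately show ?thesis using map_listed[where V = Union and f = fst, OF finite_induced[OF B] inj] by simp
qed

text \<open>The closure of the clan is applied with the root labels as the sets
  \<open>X b\<close>.\<close>

lemma induced_delegation:
  assumes B: "B \<noteq> {}" "B \<subseteq> {..<length Cs}" and Z: "Z \<in> comps H (roots Cs B)"
  shows "clan_delegation \<UU> \<Xi> (induced_constructs Cs B Z) (induce H Z)"
proof unfold_locales
  let ?X = "\<lambda>b. root_label (tree b)"
  have "\<forall>b\<in>B. ?X b \<noteq> {} \<and> ?X b \<subseteq> \<Union>(map fst Cs ! b)"
  proof
    fix b assume "b \<in> B"
    then have "b < length Cs" using B(2) by auto
    then show "?X b \<noteq> {} \<and> ?X b \<subseteq> \<Union>(map fst Cs ! b)" using root_tree by simp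
  qed
  then have "(induced_parts (map fst Cs) B ?X Z, induce H Z) \<in> \<Xi>"
    using clan team B Z unfolding ordered_strict_clan_def roots_def by auto
  moreover have "construct K C" if "(K, C) \<in> set (induced_constructs Cs B Z)" for K C
    using inducedD[OF B(2), of K C Z] that set_induced_constructs[OF B(2)] by auto
  ultimately show "is_delegation \<Xi> (induced_constructs Cs B Z, induce H Z)"
    using map_fst_induced_constructs[OF B(2), of ?X Z] by (auto simp: is_delegation_def)
qed

end

section \<open>Intervals of the flip order\<close>

lemma top_part_root: "root_label C \<inter> e \<noteq> {} \<Longrightarrow> top_part C e = root_label C \<inter> e"
  by (cases C) (simp add: top_part_Node)

definition restricting :: "(hypergraph \<times> ctree) list \<Rightarrow> hypergraph \<Rightarrow> ctree set" where
  "restricting Cs H = {U. construct H U \<and> restricts_to Cs U}"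

definition restricting_at :: "nat set \<Rightarrow> (hypergraph \<times> ctree) list \<Rightarrow> hypergraph \<Rightarrow> ctree set" where
  "restricting_at B Cs H = {U. construct H U \<and> root_label U = roots Cs B \<and> restricts_to Cs U}"

definition extreme_index :: "bool \<Rightarrow> (hypergraph \<times> ctree) list \<Rightarrow> nat" where
  "extreme_index d Cs = (if d then 0 else length Cs - 1)"

text \<open>The end of the interval towards which \<open>directed_le d\<close> moves.\<close>

definition extreme :: "bool \<Rightarrow> (hypergraph \<times> ctree) list \<Rightarrow> hypergraph \<Rightarrow> ctree" where
  "extreme d Cs H = (if d then backslash Cs H else slash Cs H)"

definition extreme_at :: "bool \<Rightarrow> nat set \<Rightarrow> (hypergraph \<times> ctree) list \<Rightarrow> hypergraph \<Rightarrow> ctree" where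
  "extreme_at d B Cs H = (if d then backslash_at B Cs H else slash_at B Cs H)"

lemma extreme_at_eq: "extreme_at d B Cs H = plant (roots Cs B) (comps H (roots Cs B))
    (\<lambda>Z. extreme d (induced_constructs Cs B Z) (induce H Z))"
  by (simp add: extreme_at_def extreme_def backslash_at_def slash_at_def)

lemma extreme_eq: "Cs \<noteq> [] \<Longrightarrow> extreme d Cs H = extreme_at d {extreme_index d Cs} Cs H"
  unfolding extreme_at_eq unfolding extreme_def extreme_index_def
  by (simp add: backslash.simps[of Cs H] slash.simps[of Cs H])

context clan_delegation
begin

lemma restricts_to_iff_set:
  assumes "construct H U"
  shows "restricts_to Cs U \<longleftrightarrow> (\<forall>K C e. (K, C) \<in> set Cs \<and> connected_in K e \<longrightarrow> top_part U e = top_part C e)"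
  unfolding restricts_to_iff[OF assms] by (metis fst_conv snd_conv in_set_conv_nth prod.collapse nth_mem)

text \<open>Connected sets of participants that avoid the root label are exactly those seen by the
  induced delegations; at the others both trees have the share of their own root, and these shares
  agree.\<close>

lemma restricts_to_plant_iff:
  assumes B: "B \<noteq> {}" "B \<subseteq> {..<length Cs}"
    and T: "\<And>Z. Z \<in> comps H (roots Cs B) \<Longrightarrow> construct (induce H Z) (T Z)"
  shows "restricts_to Cs (plant (roots Cs B) (comps H (roots Cs B)) T) \<longleftrightarrow>
    (\<forall>Z\<in>comps H (roots Cs B). restricts_to (induced_constructs Cs B Z) (T Z))"
proof -
  let ?R = "roots Cs B"
  let ?U = "plant ?R (comps H ?R) T"
  note H = hypergraph_H
  have U: "construct H ?U" by (rule construct_plantI[OF H hg_connected_H]) (use roots_bounds[OF B] T in auto)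
  have child: "restricts_to (induced_constructs Cs B Z) (T Z) \<longleftrightarrow>
      (\<forall>K C e. (K, C) \<in> induced B Z \<and> connected_in K e \<longrightarrow> top_part (T Z) e = top_part C e)"
    if "Z \<in> comps H ?R" for Z
    using clan_delegation.restricts_to_iff_set[OF induced_delegation[OF B that] T[OF that]]
    unfolding set_induced_constructs[OF B(2)] .
  show ?thesis
  proof (intro iffI ballI)
    fix Z assume U': "restricts_to Cs ?U" and Z: "Z \<in> comps H ?R"
    have "top_part (T Z) e = top_part C e" if KC: "(K, C) \<in> induced B Z" and e: "connected_in K e" for K C e
    proof -
      obtain a where a: "a < length Cs" "K = induce (part a) (\<Union>K)" "\<Union>K \<subseteq> \<Union>(part a)" "\<Union>K \<subseteq> Z"
        "\<forall>e\<subseteq>\<Union>K. top_part C e = top_part (tree a) e"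
        using inducedD[OF B(2) KC] by metis
      have eK: "e \<subseteq> \<Union>K" using connected_in_subset[OF e] .
      then have eZ: "e \<subseteq> Z" using a(4) by (rule order_trans)
      have "connected_in (part a) e" using connected_in_induce[OF hypergraph_part[OF a(1)] a(3)] e a(2) by metis
      then have "top_part ?U e = top_part (tree a) e" using U' a(1) restricts_to_iff[OF U] by blast
      then show ?thesis using a(5) eK top_part_comp[OF H Z eZ T] by simp
    qed
    then show "restricts_to (induced_constructs Cs B Z) (T Z)" using child[OF Z] by blast
  next
    assume R: "\<forall>Z\<in>comps H ?R. restricts_to (induced_constructs Cs B Z) (T Z)"
    have sub: "top_part (T Z) e = top_part C e"
      if "Z \<in> comps H ?R" "(K, C) \<in> induced B Z" "connected_in K e" for Z K C e
      using R child that by blast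
    have "top_part ?U e = top_part (tree a) e" if a: "a < length Cs" and e: "connected_in (part a) e" for a e
    proof -
      note Ka = hypergraph_part[OF a]
      have ea: "e \<subseteq> \<Union>(part a)" using connected_in_subset[OF e] .
      note inter = roots_inter[OF B(2) a]
      show ?thesis
      proof (cases "?R \<inter> e = {}")
        case False
        have "a \<in> B" using False inter ea by (auto split: if_splits)
        then have "?R \<inter> e = root_label (tree a) \<inter> e" using inter ea by auto
        then show ?thesis using False top_part_root[of ?U e] top_part_root[of "tree a" e] by simp
      next
        case off: True
        show ?thesis
        proof (cases "a \<in> B")
          case False
          \<comment> \<open>An untouched participant is connected in \<open>H\<close>, so it lies
            whole in one component and is itself a participant there.\<close>
          then have "\<Union>(part a) \<inter> ?R = {}" using inter by auto
          from comp_containing[OF H connected_in_part[OF a connected_part[OF a]] this]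
          obtain Z where Z: "Z \<in> comps H ?R" "\<Union>(part a) \<subseteq> Z" by blast
          have eZ: "e \<subseteq> Z" using ea Z(2) by (rule order_trans)
          show ?thesis
            using sub[OF Z(1) induced_old[OF a False Z(2)] e] top_part_comp[OF H Z(1) eZ T] by simp
        next
          case True
          \<comment> \<open>The set \<open>e\<close> is located twice: in a component
            \<open>Y\<close> of its participant minus the root, and then, as \<open>Y\<close> is
            connected in \<open>H\<close>, in a component \<open>Z\<close> of \<open>H\<close>
            around \<open>Y\<close>.\<close>
          have "e \<inter> root_label (tree a) = {}" using off inter True by auto
          from comp_containing[OF Ka e this]
          obtain Y where Y: "Y \<in> comps (part a) (root_label (tree a))" "e \<subseteq> Y" by blast
          have Ya: "Y \<subseteq> \<Union>(part a)" by (rule comps_subset[OF Ka Y(1)])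
          have "Y \<inter> ?R = {}" using comps_disjoint_deleted[OF Ka Y(1)] Ya inter True by auto
          from comp_containing[OF H connected_in_part[OF a comps_connected_in[OF Ka Y(1)]] this]
          obtain Z where Z: "Z \<in> comps H ?R" "Y \<subseteq> Z" by blast
          obtain C where C: "(induce (part a) Y, C) \<in> induced B Z"
            using induced_new[OF B(2) True Y(1) Z(2)] by blast
          have UY: "\<Union>(induce (part a) Y) = Y" by (rule Union_comp[OF Ka Y(1)])
          obtain a' where a': "a' < length Cs" "Y \<subseteq> \<Union>(part a')" "\<forall>e\<subseteq>Y. top_part C e = top_part (tree a') e"
            using inducedD[OF B(2) C] unfolding UY by metis
          \<comment> \<open>\<open>inducedD\<close> only promises some original index; disjointness
            of the participants identifies it.\<close>
          have "a' = a"
            using part_disjoint[OF a'(1) a] a'(2) Ya comps_nonempty[OF Ka Y(1)] by blast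
          moreover have "connected_in (induce (part a) Y) e" using connected_in_induce[OF Ka Ya] e Y(2) by blast
          moreover have "e \<subseteq> Z" using Y(2) Z(2) by (rule order_trans)
          ultimately show ?thesis using sub[OF Z(1) C] a'(3) Y(2) top_part_comp[OF H Z(1) _ T] by simp
        qed
      qed
    qed
    then show "restricts_to Cs ?U" using restricts_to_iff[OF U] by blast
  qed
qed

lemma plant_restricting_at:
  assumes B: "B \<noteq> {}" "B \<subseteq> {..<length Cs}"
    and T: "\<And>Z. Z \<in> comps H (roots Cs B) \<Longrightarrow> T Z \<in> restricting (induced_constructs Cs B Z) (induce H Z)"
  shows "plant (roots Cs B) (comps H (roots Cs B)) T \<in> restricting_at B Cs H"
proof -
  have T': "construct (induce H Z) (T Z)" if "Z \<in> comps H (roots Cs B)" for Z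
    using T[OF that] by (simp add: restricting_def)
  have "construct H (plant (roots Cs B) (comps H (roots Cs B)) T)"
    by (rule construct_plantI[OF hypergraph_H hg_connected_H]) (use roots_bounds[OF B] T' in auto)
  then show ?thesis
    using restricts_to_plant_iff[OF B T'] T by (simp add: restricting_at_def restricting_def)
qed

lemma restricting_at_cases:
  assumes B: "B \<noteq> {}" "B \<subseteq> {..<length Cs}" and U: "U \<in> restricting_at B Cs H"
  obtains T where "U = plant (roots Cs B) (comps H (roots Cs B)) T"
    "\<And>Z. Z \<in> comps H (roots Cs B) \<Longrightarrow> T Z \<in> restricting (induced_constructs Cs B Z) (induce H Z)"
proof -
  have U': "construct H U" "root_label U = roots Cs B" "restricts_to Cs U"
    using U by (auto simp: restricting_at_def)
  from U'(1) show ?thesis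
  proof (cases rule: construct_cases)
    case (plant Y T)
    have Y: "Y = roots Cs B" using U'(2) plant(1) by simp
    note c = plant(6)[unfolded Y]
    have "\<forall>Z\<in>comps H (roots Cs B). restricts_to (induced_constructs Cs B Z) (T Z)"
      using restricts_to_plant_iff[OF B c] U'(3) unfolding plant(1) Y by blast
    then have "T Z \<in> restricting (induced_constructs Cs B Z) (induce H Z)" if "Z \<in> comps H (roots Cs B)" for Z
      using c that by (simp add: restricting_def)
    then show ?thesis using that plant(1) Y by blast
  qed
qed

text \<open>The value at all of a participant that the root meets is forced to be the root label of
  its construct, and the participants cover \<open>H\<close>.\<close>

lemma restricting_root:
  assumes "U \<in> restricting Cs H"
  shows "\<exists>B. B \<noteq> {} \<and> B \<subseteq> {..<length Cs} \<and> U \<in> restricting_at B Cs H"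
proof -
  have U: "construct H U" "restricts_to Cs U" using assms by (auto simp: restricting_def)
  define X where "X = root_label U"
  have X: "X \<noteq> {}" "X \<subseteq> \<Union>H"
  proof -
    from U(1) have "root_label U \<noteq> {} \<and> root_label U \<subseteq> \<Union>H" by (rule construct_cases) simp
    then show "X \<noteq> {}" "X \<subseteq> \<Union>H" unfolding X_def by blast+
  qed
  define B where "B = {a. a < length Cs \<and> X \<inter> \<Union>(part a) \<noteq> {}}"
  have "X \<inter> \<Union>(part a) = root_label (tree a)" if a: "a \<in> B" for a
  proof -
    have a': "a < length Cs" "X \<inter> \<Union>(part a) \<noteq> {}" using a by (auto simp: B_def)
    have "X \<inter> \<Union>(part a) = top_part U (\<Union>(part a))"
      using top_part_root[of U "\<Union>(part a)"] a'(2) by (simp add: X_def)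
    also have "\<dots> = top_part (tree a) (\<Union>(part a))"
      using restricts_to_iff[OF U(1)] U(2) a'(1) connected_part[OF a'(1)] by blast
    also have "\<dots> = root_label (tree a)" by (rule top_part_whole[OF construct_tree[OF a'(1)]])
    finally show ?thesis .
  qed
  then have "roots Cs B = (\<Union>a\<in>B. X \<inter> \<Union>(part a))" unfolding roots_def by (intro SUP_cong) auto
  also have "\<dots> = (\<Union>a<length Cs. X \<inter> \<Union>(part a))" by (auto simp: B_def)
  also have "\<dots> = X \<inter> \<Union>H" unfolding part_cover by (simp only: Int_UN_distrib)
  also have "\<dots> = X" using X(2) by (rule Int_absorb2)
  finally have r: "roots Cs B = X" .
  then have "B \<noteq> {}" using X(1) by (auto simp: roots_def)
  moreover have "B \<subseteq> {..<length Cs}" by (auto simp: B_def)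
  ultimately show ?thesis using U r unfolding restricting_at_def X_def by blast
qed

lemma extreme_index: "{extreme_index d Cs} \<subseteq> {..<length Cs}"
  using nonempty by (auto simp: extreme_index_def)

lemma extreme_part_before: "before d (\<Union>(part (extreme_index d Cs))) (\<Union>H - \<Union>(part (extreme_index d Cs)))"
proof -
  let ?i = "extreme_index d Cs"
  have "before d (\<Union>(part ?i)) (\<Union>(part b))" if "b < length Cs" "b \<noteq> ?i" for b
  proof (cases d)
    case True
    then show ?thesis using that part_before(1)[of 0 b] by (simp add: extreme_index_def)
  next
    case False
    then have "b < length Cs - 1" using that by (auto simp: extreme_index_def)
    then show ?thesis using False part_before(2)[of b "length Cs - 1"] nonempty by (simp add: extreme_index_def)
  qed
  moreover have "\<exists>b<length Cs. b \<noteq> ?i \<and> y \<in> \<Union>(part b)" if "y \<in> \<Union>H - \<Union>(part ?i)" for y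
    using that part_cover by auto
  ultimately show ?thesis unfolding before_def by meson
qed

end

section \<open>Reaching the two ends of the interval\<close>

lemma extreme_restricting:
  "clan_delegation \<UU> \<Xi> Cs H \<Longrightarrow> extreme d Cs H \<in> restricting Cs H"
proof (induction "weight Cs" arbitrary: Cs H rule: less_induct)
  case less
  interpret clan_delegation \<UU> \<Xi> Cs H by (rule less.prems)
  have "extreme d Cs H \<in> restricting_at {extreme_index d Cs} Cs H"
    unfolding extreme_eq[OF nonempty] extreme_at_eq
    by (rule plant_restricting_at[OF _ extreme_index])
      (auto intro!: less.hyps weight_induced induced_delegation[OF _ extreme_index] simp: extreme_index[simplified])
  then show ?case by (simp add: restricting_at_def restricting_def)
qed

lemma directed_le_extreme:
  "clan_delegation \<UU> \<Xi> Cs H \<Longrightarrow> U \<in> restricting Cs H \<Longrightarrow> directed_le d H U (extreme d Cs H)"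
proof (induction "weight Cs" arbitrary: Cs H U rule: less_induct)
  case less
  interpret clan_delegation \<UU> \<Xi> Cs H by (rule less.prems)
  let ?i = "extreme_index d Cs"
  let ?R = "roots Cs {?i}"
  have i: "?i < length Cs" using extreme_index by simp
  have U: "construct H U" "restricts_to Cs U" using less.prems(2) by (auto simp: restricting_def)
  have "top_part U (\<Union>(part ?i)) = top_part (tree ?i) (\<Union>(part ?i))"
    using restricts_to_iff[OF U(1)] U(2) i connected_part[OF i] by blast
  then have top: "top_part U (\<Union>(part ?i)) = ?R"
    using top_part_whole[OF construct_tree[OF i]] by simp
  \<comment> \<open>The extreme participant comes, in direction \<open>d\<close>, before all other
    vertices, as the pulling lemma requires.\<close>
  obtain V where V: "directed_le d H U V" "construct H V" "root_label V = ?R"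
    "\<And>e. connected_in H e \<Longrightarrow> e \<inter> ?R = {} \<Longrightarrow> top_part V e = top_part U e"
    using directed_le_pull[OF U(1) comps_ordered_H connected_in_part[OF i connected_part[OF i]] extreme_part_before]
    unfolding top by metis
  \<comment> \<open>Sets avoiding the new root keep their value. A set meeting it belongs to the
    extreme participant, whose construct has the same root as \<open>V\<close>.\<close>
  have "top_part V e = top_part (tree a) e" if a: "a < length Cs" and e: "connected_in (part a) e" for a e
  proof (cases "e \<inter> ?R = {}")
    case True
    then show ?thesis
      using V(4)[OF connected_in_part[OF a e]] restricts_to_iff[OF U(1)] U(2) a e by metis
  next
    case False
    have "a = ?i"
    proof (rule ccontr)
      assume "a \<noteq> ?i"
      then have "?R \<inter> \<Union>(part a) = {}" using roots_inter[OF extreme_index[of d] a] by simp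
      then show False using False connected_in_subset[OF e] by blast
    qed
    then show ?thesis using False top_part_root[of V e] top_part_root[of "tree a" e] V(3) by (simp add: Int_commute)
  qed
  then have "V \<in> restricting_at {?i} Cs H"
    using V(2,3) restricts_to_iff[OF V(2)] by (simp add: restricting_at_def)
  then obtain T where T: "V = plant ?R (comps H ?R) T"
    "\<And>Z. Z \<in> comps H ?R \<Longrightarrow> T Z \<in> restricting (induced_constructs Cs {?i} Z) (induce H Z)"
    using restricting_at_cases[OF _ extreme_index] by (metis insert_not_empty)
  have "directed_le d H V (extreme_at d {?i} Cs H)"
    unfolding T(1) extreme_at_eq
  proof (rule directed_le_plant[OF hypergraph_H hg_connected_H])
    show "?R \<noteq> {}" "?R \<subseteq> \<Union>H" using roots_bounds[OF _ extreme_index] by blast+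
    fix Z assume Z: "Z \<in> comps H ?R"
    show "construct (induce H Z) (T Z)" using T(2)[OF Z] by (simp add: restricting_def)
    show "directed_le d (induce H Z) (T Z) (extreme d (induced_constructs Cs {?i} Z) (induce H Z))"
      by (rule less.hyps[OF weight_induced[OF _ extreme_index] induced_delegation[OF _ extreme_index Z] T(2)[OF Z]]) simp_all
  qed
  then show ?case unfolding extreme_eq[OF nonempty] by (rule directed_le_trans[OF V(1)])
qed

context clan_delegation
begin

lemma restricting_interval:
  "restricting Cs H = {U. construct H U \<and> flip_le H (slash Cs H) U \<and> flip_le H U (backslash Cs H)}"
proof (intro equalityI subsetI)
  fix U assume U: "U \<in> restricting Cs H"
  then show "U \<in> {U. construct H U \<and> flip_le H (slash Cs H) U \<and> flip_le H U (backslash Cs H)}"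
    using directed_le_extreme[OF clan_delegation_axioms U, of True]
      directed_le_extreme[OF clan_delegation_axioms U, of False]
    by (simp add: directed_le_True directed_le_False extreme_def restricting_def)
next
  fix U assume "U \<in> {U. construct H U \<and> flip_le H (slash Cs H) U \<and> flip_le H U (backslash Cs H)}"
  then have U: "construct H U" "flip_le H (slash Cs H) U" "flip_le H U (backslash Cs H)" by auto
  have ends: "construct H (slash Cs H)" "restricts_to Cs (slash Cs H)"
    "construct H (backslash Cs H)" "restricts_to Cs (backslash Cs H)"
    using extreme_restricting[OF clan_delegation_axioms, of True]
      extreme_restricting[OF clan_delegation_axioms, of False]
    by (auto simp: restricting_def extreme_def)
  have "top_part U e = top_part (tree a) e" if a: "a < length Cs" and e: "connected_in (part a) e" for a e
    using flip_interval_top_part[OF U(2,3) connected_in_part[OF a e]]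
      restricts_to_iff[OF ends(1)] restricts_to_iff[OF ends(3)] ends(2,4) a e by simp
  then show "U \<in> restricting Cs H"
    using restricts_to_iff[OF U(1)] U(1) by (simp add: restricting_def)
qed

lemma restricting_at_interval:
  assumes B: "B \<noteq> {}" "B \<subseteq> {..<length Cs}"
  shows "restricting_at B Cs H =
    {U. construct H U \<and> flip_le H (slash_at B Cs H) U \<and> flip_le H U (backslash_at B Cs H)}"
proof (intro equalityI subsetI)
  let ?R = "roots Cs B"
  fix U assume U: "U \<in> restricting_at B Cs H"
  then obtain T where T: "U = plant ?R (comps H ?R) T"
    "\<And>Z. Z \<in> comps H ?R \<Longrightarrow> T Z \<in> restricting (induced_constructs Cs B Z) (induce H Z)"
    using restricting_at_cases[OF B] by blast
  have "directed_le d H U (extreme_at d B Cs H)" for d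
    unfolding T(1) extreme_at_eq
  proof (rule directed_le_plant[OF hypergraph_H hg_connected_H])
    show "?R \<noteq> {}" "?R \<subseteq> \<Union>H" using roots_bounds[OF B] by blast+
    fix Z assume Z: "Z \<in> comps H ?R"
    show "construct (induce H Z) (T Z)" using T(2)[OF Z] by (simp add: restricting_def)
    show "directed_le d (induce H Z) (T Z) (extreme d (induced_constructs Cs B Z) (induce H Z))"
      by (rule directed_le_extreme[OF induced_delegation[OF B Z] T(2)[OF Z]])
  qed
  from this[of True] this[of False]
  show "U \<in> {U. construct H U \<and> flip_le H (slash_at B Cs H) U \<and> flip_le H U (backslash_at B Cs H)}"
    using U by (simp add: directed_le_True directed_le_False extreme_at_def restricting_at_def)
next
  fix U assume "U \<in> {U. construct H U \<and> flip_le H (slash_at B Cs H) U \<and> flip_le H U (backslash_at B Cs H)}"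
  then have U: "construct H U" "flip_le H (slash_at B Cs H) U" "flip_le H U (backslash_at B Cs H)" by auto
  have "extreme_at d B Cs H \<in> restricting_at B Cs H" for d
    unfolding extreme_at_eq
    by (rule plant_restricting_at[OF B]) (rule extreme_restricting[OF induced_delegation[OF B]])
  from this[of True] this[of False]
  have ends: "construct H (slash_at B Cs H)" "root_label (slash_at B Cs H) = roots Cs B"
    "restricts_to Cs (slash_at B Cs H)" "construct H (backslash_at B Cs H)"
    "root_label (backslash_at B Cs H) = roots Cs B" "restricts_to Cs (backslash_at B Cs H)"
    by (auto simp: restricting_at_def extreme_at_def)
  have "top_part U e = top_part (tree a) e" if a: "a < length Cs" and e: "connected_in (part a) e" for a e
    using flip_interval_top_part[OF U(2,3) connected_in_part[OF a e]]
      restricts_to_iff[OF ends(1)] restricts_to_iff[OF ends(4)] ends(3,6) a e by simp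
  \<comment> \<open>Both ends have root label \<open>roots Cs B\<close>; evaluating at the connected
    set \<open>\<Union>H\<close> forces it on everything between them.\<close>
  moreover have "root_label U = roots Cs B"
    using flip_interval_top_part[OF U(2,3), of "\<Union>H"] hg_connected_H hg_connected_iff ends(2,5)
      top_part_whole[OF U(1)] top_part_whole[OF ends(1)] top_part_whole[OF ends(4)] by simp
  ultimately show "U \<in> restricting_at B Cs H"
    using restricts_to_iff[OF U(1)] U(1) by (simp add: restricting_at_def)
qed

end

section \<open>Sums over constructs\<close>

text \<open>A construct is determined by its values, and these form a function between finite sets;
  \<open>restrict\<close> makes the function extensional.\<close>

lemma finite_constructs: "hypergraph H \<Longrightarrow> finite {U. construct H U}"
proof -
  assume H: "hypergraph H"
  let ?f = "\<lambda>U. restrict (top_part U) (Pow (\<Union>H))"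
  have fin: "finite (Pow (\<Union>H))" using H by (simp add: hypergraph_def)
  have "?f U \<in> (\<Pi>\<^sub>E e\<in>Pow (\<Union>H). Pow (\<Union>H))" for U
  proof (rule restrict_PiE_iff[THEN iffD2], rule ballI)
    fix e assume "e \<in> Pow (\<Union>H)"
    then show "top_part U e \<in> Pow (\<Union>H)" using top_part_subset[of U e] by (metis Pow_iff le_inf_iff order_trans)
  qed
  then have "?f ` {U. construct H U} \<subseteq> (\<Pi>\<^sub>E e\<in>Pow (\<Union>H). Pow (\<Union>H))" by blast
  then have "finite (?f ` {U. construct H U})" using finite_PiE[OF fin, of "\<lambda>_. Pow (\<Union>H)"] fin by (metis finite_subset)
  moreover have "inj_on ?f {U. construct H U}"
  proof (rule inj_onI)
    fix U V assume UV: "U \<in> {U. construct H U}" "V \<in> {U. construct H U}" and eq: "?f U = ?f V"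
    show "U = V"
    proof (rule construct_eqI[of H])
      fix e assume "connected_in H e"
      then have "e \<in> Pow (\<Union>H)" using connected_in_subset by blast
      then show "top_part U e = top_part V e" using fun_cong[OF eq, of e] by (simp only: restrict_apply if_True)
    qed (use UV in auto)
  qed
  ultimately show ?thesis by (rule finite_imageD)
qed

section \<open>Scaling and grafting of formal sums\<close>

lemma lookup_scal: "Poly_Mapping.lookup (scal r v) k = r * Poly_Mapping.lookup v k"
  by (simp add: scal_def map.rep_eq when_def)

lemma scal_sum_single:
  "scal r (\<Sum>x\<in>A. Poly_Mapping.single (f x) (c x)) = (\<Sum>x\<in>A. Poly_Mapping.single (f x) (r * c x))"
  by (rule poly_mapping_eqI)
    (simp add: lookup_scal lookup_sum lookup_single sum_distrib_left when_def if_distrib cong: if_cong)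

text \<open>\<open>graft\<close> runs over supports, which can be smaller than the sets
  \<open>R Z\<close>: with \<open>q = 0\<close> some coefficients vanish. The additional terms have
  a zero factor.\<close>

lemma graft_sum:
  assumes I: "finite I" and R: "\<And>Z. Z \<in> I \<Longrightarrow> finite (R Z)"
    and v: "\<And>Z. Z \<in> I \<Longrightarrow> v Z = (\<Sum>U\<in>R Z. Poly_Mapping.single U (c Z U))"
  shows "graft X I v = (\<Sum>T\<in>(\<Pi>\<^sub>E Z\<in>I. R Z). Poly_Mapping.single (plant X I T) (\<Prod>Z\<in>I. c Z (T Z)))"
proof -
  have l: "Poly_Mapping.lookup (v Z) U = (if U \<in> R Z then c Z U else 0)" if "Z \<in> I" for Z U
    using R[OF that] unfolding v[OF that]
    by (simp add: lookup_sum lookup_single when_def if_distrib sum.delta cong: if_cong)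
  have keys: "Poly_Mapping.keys (v Z) \<subseteq> R Z" if "Z \<in> I" for Z
    using l[OF that] by (auto simp: in_keys_iff split: if_splits)
  have "graft X I v = (\<Sum>T\<in>(\<Pi>\<^sub>E Z\<in>I. R Z).
      Poly_Mapping.single (plant X I T) (\<Prod>Z\<in>I. Poly_Mapping.lookup (v Z) (T Z)))"
    unfolding graft_def
  proof (rule sum.mono_neutral_left)
    show "finite (\<Pi>\<^sub>E Z\<in>I. R Z)" using I R by (rule finite_PiE)
    show "(\<Pi>\<^sub>E Z\<in>I. Poly_Mapping.keys (v Z)) \<subseteq> (\<Pi>\<^sub>E Z\<in>I. R Z)" by (rule PiE_mono) (rule keys)
    show "\<forall>T\<in>(\<Pi>\<^sub>E Z\<in>I. R Z) - (\<Pi>\<^sub>E Z\<in>I. Poly_Mapping.keys (v Z)).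
        Poly_Mapping.single (plant X I T) (\<Prod>Z\<in>I. Poly_Mapping.lookup (v Z) (T Z)) = 0"
    proof
      fix T assume T: "T \<in> (\<Pi>\<^sub>E Z\<in>I. R Z) - (\<Pi>\<^sub>E Z\<in>I. Poly_Mapping.keys (v Z))"
      then obtain Z where "Z \<in> I" "Poly_Mapping.lookup (v Z) (T Z) = 0"
        by (auto simp: PiE_iff in_keys_iff)
      then have "(\<Prod>Z\<in>I. Poly_Mapping.lookup (v Z) (T Z)) = 0" using I by (meson prod_zero)
      then show "Poly_Mapping.single (plant X I T) (\<Prod>Z\<in>I. Poly_Mapping.lookup (v Z) (T Z)) = 0" by simp
    qed
  qed
  also have "\<dots> = (\<Sum>T\<in>(\<Pi>\<^sub>E Z\<in>I. R Z). Poly_Mapping.single (plant X I T) (\<Prod>Z\<in>I. c Z (T Z)))"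
  proof (rule sum.cong[OF refl])
    fix T assume "T \<in> (\<Pi>\<^sub>E Z\<in>I. R Z)"
    then have "(\<Prod>Z\<in>I. Poly_Mapping.lookup (v Z) (T Z)) = (\<Prod>Z\<in>I. c Z (T Z))"
      by (intro prod.cong refl) (simp add: l PiE_mem)
    then show "Poly_Mapping.single (plant X I T) (\<Prod>Z\<in>I. Poly_Mapping.lookup (v Z) (T Z)) =
        Poly_Mapping.single (plant X I T) (\<Prod>Z\<in>I. c Z (T Z))" by simp
  qed
  finally show ?thesis .
qed

lemma star_restr_eq: "star_restr q Cs H = (\<Sum>U\<in>restricting Cs H. Poly_Mapping.single U (q ^ mu (map fst Cs) U))"
  by (simp add: star_restr_def restricting_def)

lemma star_restr_at_eq: "star_restr_at q B Cs H =
    (\<Sum>U\<in>restricting_at B Cs H. Poly_Mapping.single U (q ^ (mu (map fst Cs) U + 1 - card B)))"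
  by (simp add: star_restr_at_def restricting_at_def)

lemma star_eq: "star q Cs H = (\<Sum>B | B \<noteq> {} \<and> B \<subseteq> {..<length Cs}. scal (q ^ (card B - 1)) (star_at q B Cs H))"
  by (subst star.simps) (simp add: star_at_def)

context clan_delegation
begin

lemma finite_restricting: "finite (restricting Cs H)"
  by (rule finite_subset[OF _ finite_constructs[OF hypergraph_H]]) (auto simp: restricting_def)

lemma finite_restricting_at: "finite (restricting_at B Cs H)"
  by (rule finite_subset[OF _ finite_constructs[OF hypergraph_H]]) (auto simp: restricting_at_def)

text \<open>Rewrites \<open>mu\<close> in terms of induced delegations instead of induced teams,
  indexed by components instead of subtrees.\<close>

lemma mu_plant:
  assumes B: "B \<noteq> {}" "B \<subseteq> {..<length Cs}"
    and T: "\<And>Z. Z \<in> comps H (roots Cs B) \<Longrightarrow> construct (induce H Z) (T Z)"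
  shows "mu (map fst Cs) (plant (roots Cs B) (comps H (roots Cs B)) T) =
    (card B - 1) + (\<Sum>Z\<in>comps H (roots Cs B). mu (map fst (induced_constructs Cs B Z)) (T Z))"
proof -
  let ?R = "roots Cs B" and ?I = "comps H (roots Cs B)"
  have fin: "finite ?I" by (rule finite_comps[OF hypergraph_H])
  have v: "verts (T Z) = Z" if "Z \<in> ?I" for Z using verts_comp[OF hypergraph_H that T[OF that]] .
  \<comment> \<open>\<open>mu\<close> sums over the set of children, so equal subtrees would be
    counted once; their vertex sets exclude this.\<close>
  have inj: "inj_on T ?I" using v by (rule inj_on_inverseI)
  have X: "?R \<inter> \<Union>(map fst Cs ! b) = root_label (tree b)" if b: "b \<in> B" for b
  proof -
    have "b < length Cs" using B(2) b by auto
    then show ?thesis using roots_inter[OF B(2), of b] b by simp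
  qed
  have "mu (map fst Cs) (plant ?R ?I T) = (card B - 1) +
      (\<Sum>u\<in>T ` ?I. mu (induced_parts (map fst Cs) B (\<lambda>b. ?R \<inter> \<Union>(map fst Cs ! b)) (verts u)) u)"
    unfolding plant_def using fin by (simp add: mu.simps meeting_roots[OF B(2)] Abs_fset_inverse)
  also have "(\<Sum>u\<in>T ` ?I. mu (induced_parts (map fst Cs) B (\<lambda>b. ?R \<inter> \<Union>(map fst Cs ! b)) (verts u)) u) =
      (\<Sum>u\<in>T ` ?I. mu (map fst (induced_constructs Cs B (verts u))) u)"
    using map_fst_induced_constructs[OF B(2), of "\<lambda>b. ?R \<inter> \<Union>(map fst Cs ! b)"] X by simp
  also have "\<dots> = (\<Sum>Z\<in>?I. mu (map fst (induced_constructs Cs B Z)) (T Z))"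
    unfolding sum.reindex[OF inj] comp_def by (rule sum.cong) (simp_all add: v)
  finally show ?thesis .
qed

lemma card_le_mu:
  assumes B: "B \<noteq> {}" "B \<subseteq> {..<length Cs}" and U: "U \<in> restricting_at B Cs H"
  shows "card B - 1 \<le> mu (map fst Cs) U"
proof -
  obtain T where T: "U = plant (roots Cs B) (comps H (roots Cs B)) T"
    "\<And>Z. Z \<in> comps H (roots Cs B) \<Longrightarrow> T Z \<in> restricting (induced_constructs Cs B Z) (induce H Z)"
    using restricting_at_cases[OF B U] by blast
  then show ?thesis using mu_plant[OF B, of T] unfolding T(1) by (auto simp: restricting_def)
qed

text \<open>Only the set of subtrees survives in the tree, but vertex sets tell which component each
  subtree belongs to, and functions in \<open>PiE\<close> are fixed outside the index set.\<close>

lemma restricting_at_bij: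
  assumes B: "B \<noteq> {}" "B \<subseteq> {..<length Cs}"
  shows "bij_betw (plant (roots Cs B) (comps H (roots Cs B)))
    (\<Pi>\<^sub>E Z\<in>comps H (roots Cs B). restricting (induced_constructs Cs B Z) (induce H Z)) (restricting_at B Cs H)"
proof -
  let ?R = "roots Cs B" and ?I = "comps H (roots Cs B)"
  let ?F = "\<Pi>\<^sub>E Z\<in>?I. restricting (induced_constructs Cs B Z) (induce H Z)"
  have fin: "finite ?I" by (rule finite_comps[OF hypergraph_H])
  have c: "construct (induce H Z) (T Z)" if "T \<in> ?F" "Z \<in> ?I" for T Z
    using PiE_mem[OF that] by (simp add: restricting_def)
  have "inj_on (plant ?R ?I) ?F"
  proof (rule inj_onI)
    fix T T' assume T: "T \<in> ?F" and T': "T' \<in> ?F" and eq: "plant ?R ?I T = plant ?R ?I T'"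
    have im: "T ` ?I = T' ` ?I" using children_plant[OF fin, of ?R] eq by metis
    show "T = T'"
    proof (rule PiE_ext[OF T T'])
      fix Z assume Z: "Z \<in> ?I"
      then obtain Z' where Z': "Z' \<in> ?I" "T Z = T' Z'" using im by blast
      then have "Z = Z'"
        using verts_comp[OF hypergraph_H Z c[OF T Z]] verts_comp[OF hypergraph_H Z'(1) c[OF T' Z'(1)]] by simp
      then show "T Z = T' Z" using Z'(2) by simp
    qed
  qed
  moreover have "plant ?R ?I ` ?F = restricting_at B Cs H"
  proof (intro equalityI subsetI)
    fix U assume "U \<in> plant ?R ?I ` ?F"
    then obtain T where "T \<in> ?F" "U = plant ?R ?I T" by blast
    then show "U \<in> restricting_at B Cs H" using plant_restricting_at[OF B, of T] PiE_mem by blast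
  next
    fix U assume "U \<in> restricting_at B Cs H"
    then obtain T where T: "U = plant ?R ?I T"
      "\<And>Z. Z \<in> ?I \<Longrightarrow> T Z \<in> restricting (induced_constructs Cs B Z) (induce H Z)"
      using restricting_at_cases[OF B] by blast
    have "U = plant ?R ?I (restrict T ?I)" unfolding T(1) by (rule plant_cong) auto
    moreover have "restrict T ?I \<in> ?F" using T(2) by auto
    ultimately show "U \<in> plant ?R ?I ` ?F" by blast
  qed
  ultimately show ?thesis by (simp add: bij_betw_def)
qed

lemma restricting_partition:
  "restricting Cs H = (\<Union>B\<in>{B. B \<noteq> {} \<and> B \<subseteq> {..<length Cs}}. restricting_at B Cs H)"
proof (intro equalityI subsetI)
  fix U assume "U \<in> restricting Cs H"
  then show "U \<in> (\<Union>B\<in>{B. B \<noteq> {} \<and> B \<subseteq> {..<length Cs}}. restricting_at B Cs H)"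
    using restricting_root by blast
qed (auto simp: restricting_def restricting_at_def)

text \<open>The product of the powers of \<open>q\<close> from the subtrees has as exponent the sum
  in \<open>mu_plant\<close>. The equality for induced delegations is a hypothesis, so that the
  lemma can be used both within the induction and after it.\<close>

lemma star_at_eq_star_restr_at:
  assumes B: "B \<noteq> {}" "B \<subseteq> {..<length Cs}"
    and IH: "\<And>Z. Z \<in> comps H (roots Cs B) \<Longrightarrow>
      star q (induced_constructs Cs B Z) (induce H Z) = star_restr q (induced_constructs Cs B Z) (induce H Z)"
  shows "star_at q B Cs H = star_restr_at q B Cs H"
proof -
  let ?R = "roots Cs B" and ?I = "comps H (roots Cs B)"
  let ?F = "\<Pi>\<^sub>E Z\<in>?I. restricting (induced_constructs Cs B Z) (induce H Z)"
  let ?m = "\<lambda>Z. mu (map fst (induced_constructs Cs B Z))"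
  have "finite B" using B(2) finite_subset by blast
  then have card: "1 \<le> card B" using B(1) by (simp add: Suc_le_eq card_gt_0_iff)
  have "star_at q B Cs H = (\<Sum>T\<in>?F. Poly_Mapping.single (plant ?R ?I T) (\<Prod>Z\<in>?I. q ^ ?m Z (T Z)))"
    unfolding star_at_def
    by (rule graft_sum)
      (use finite_comps[OF hypergraph_H] clan_delegation.finite_restricting[OF induced_delegation[OF B]]
        in \<open>auto simp: IH star_restr_eq\<close>)
  also have "\<dots> = (\<Sum>T\<in>?F. Poly_Mapping.single (plant ?R ?I T) (q ^ (mu (map fst Cs) (plant ?R ?I T) + 1 - card B)))"
  proof (rule sum.cong[OF refl])
    fix T assume T: "T \<in> ?F"
    have "construct (induce H Z) (T Z)" if "Z \<in> ?I" for Z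
      using PiE_mem[OF T that] by (simp add: restricting_def)
    from mu_plant[OF B this]
    have "mu (map fst Cs) (plant ?R ?I T) + 1 - card B = (\<Sum>Z\<in>?I. ?m Z (T Z))" using card by simp
    then show "Poly_Mapping.single (plant ?R ?I T) (\<Prod>Z\<in>?I. q ^ ?m Z (T Z)) =
        Poly_Mapping.single (plant ?R ?I T) (q ^ (mu (map fst Cs) (plant ?R ?I T) + 1 - card B))"
      by (simp add: power_sum)
  qed
  also have "\<dots> = star_restr_at q B Cs H"
    unfolding star_restr_at_eq by (rule sum.reindex_bij_betw[OF restricting_at_bij[OF B]])
  finally show ?thesis .
qed

text \<open>The same expansion over \<open>B\<close> as in the recursion of \<open>star\<close>:
  restricting trees are sorted by the set of participants that their root meets.\<close>

lemma star_restr_partition: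
  "star_restr q Cs H = (\<Sum>B | B \<noteq> {} \<and> B \<subseteq> {..<length Cs}. scal (q ^ (card B - 1)) (star_restr_at q B Cs H))"
proof -
  let ?Bs = "{B. B \<noteq> {} \<and> B \<subseteq> {..<length Cs}}"
  have "finite ?Bs" by (rule finite_subset[of _ "Pow {..<length Cs}"]) auto
  moreover have "restricting_at B Cs H \<inter> restricting_at B' Cs H = {}"
    if "B \<in> ?Bs" "B' \<in> ?Bs" "B \<noteq> B'" for B B'
    using that meeting_roots[of B] meeting_roots[of B'] by (auto simp: restricting_at_def)
  ultimately have "star_restr q Cs H =
      (\<Sum>B\<in>?Bs. \<Sum>U\<in>restricting_at B Cs H. Poly_Mapping.single U (q ^ mu (map fst Cs) U))"
    unfolding star_restr_eq restricting_partition
    by (intro sum.UNION_disjoint) (auto simp: finite_restricting_at)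
  also have "\<dots> = (\<Sum>B\<in>?Bs. scal (q ^ (card B - 1)) (star_restr_at q B Cs H))"
  proof (rule sum.cong[OF refl])
    fix B assume "B \<in> ?Bs"
    then have B: "B \<noteq> {}" "B \<subseteq> {..<length Cs}" by auto
    then have "finite B" using finite_subset by blast
    then have "card B \<ge> 1" using B(1) by (simp add: Suc_le_eq card_gt_0_iff)
    \<comment> \<open>Truncated subtraction is harmless: \<open>card B\<close> is at least 1 and
      \<open>card B - 1\<close> is at most \<open>mu\<close>, so the two exponents add up.\<close>
    then have "q ^ mu (map fst Cs) U = q ^ (card B - 1) * q ^ (mu (map fst Cs) U + 1 - card B)"
      if "U \<in> restricting_at B Cs H" for U
      using card_le_mu[OF B that] by (simp flip: power_add)
    then show "(\<Sum>U\<in>restricting_at B Cs H. Poly_Mapping.single U (q ^ mu (map fst Cs) U)) =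
        scal (q ^ (card B - 1)) (star_restr_at q B Cs H)"
      unfolding star_restr_at_eq scal_sum_single by (intro sum.cong refl) simp
  qed
  finally show ?thesis .
qed

end

lemma star_eq_star_restr:
  "clan_delegation \<UU> \<Xi> Cs H \<Longrightarrow> star q Cs H = star_restr q Cs H"
proof (induction "weight Cs" arbitrary: Cs H rule: less_induct)
  case less
  interpret clan_delegation \<UU> \<Xi> Cs H by (rule less.prems)
  have "star_at q B Cs H = star_restr_at q B Cs H" if B: "B \<noteq> {}" "B \<subseteq> {..<length Cs}" for B
    by (rule star_at_eq_star_restr_at[OF B]) (rule less.hyps[OF weight_induced[OF B] induced_delegation[OF B]])
  then show ?case unfolding star_eq star_restr_partition by (intro sum.cong refl) auto
qed

theorem theorem4p5:
  fixes \<UU> :: "hypergraph set" and \<Xi> :: "team set" and q :: real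
    and Cs :: "(hypergraph \<times> ctree) list" and H :: hypergraph and B :: "nat set"
  assumes "ordered_universe \<UU>"
    and "ordered_strict_clan \<UU> \<Xi>"
    and "associative_clan \<Xi>"
    and "is_delegation \<Xi> (Cs, H)"
    and "B \<noteq> {}" and "B \<subseteq> {..<length Cs}"
  shows "star q Cs H = star_restr q Cs H \<and> star_restr q Cs H = star_le q Cs H \<and>
    star_at q B Cs H = star_restr_at q B Cs H \<and> star_restr_at q B Cs H = star_le_at q B Cs H"
proof -
  interpret clan_delegation \<UU> \<Xi> Cs H using assms(1,2,4) by unfold_locales
  note B = assms(5,6)
  \<comment> \<open>The equality for the full products, already known for all induced delegations,
    discharges the hypothesis on the subtrees.\<close>
  have "star_at q B Cs H = star_restr_at q B Cs H"
    by (rule star_at_eq_star_restr_at[OF B]) (rule star_eq_star_restr[OF induced_delegation[OF B]])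
  moreover have "star_restr q Cs H = star_le q Cs H"
    unfolding star_restr_eq star_le_def restricting_interval ..
  moreover have "star_restr_at q B Cs H = star_le_at q B Cs H"
    unfolding star_restr_at_eq star_le_at_def restricting_at_interval[OF B] ..
  ultimately show ?thesis using star_eq_star_restr[OF clan_delegation_axioms] by blast
qed

end
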